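(* Let $n\in\mathbb{N}$ and let $\mathcal{H}$ be an infinite-dimensional Hilbert space. For each $r\in(0,+\infty]$, $\mathrm{Hol}(\mathcal{B}(\mathcal{H})^n_r)=\mathcal{F}(\mathbb{B}^n_r)$ as topological algebras; that is, both are the same subalgebra of $\mathfrak{F}_n$ and their topologies coincide.
   Context: $W_{n,d}=\{1,\dots,n\}^d$, $W_n=\bigsqcup_{d\ge0}W_{n,d}$; for $\alpha\in W_{n,d}$ put $|\alpha|=d$; for an $n$-tuple $T$ in an algebra put $T_\alpha=T_{\alpha_1}\cdots T_{\alpha_d}$ ($=1$ if $d=0$). $\mathfrak{F}_n$ is the algebra of all formal series $\sum_{\alpha\in W_n}c_\alpha\zeta_\alpha$ ($c_\alpha\in\mathbb{C}$) in free variables $\zeta_1,\dots,\zeta_n$. The free ball algebra is $$\mathcal{F}(\mathbb{B}^n_r)=\Bigl\{a=\sum_{\alpha}c_\alpha\zeta_\alpha\in\mathfrak{F}_n:\ \|a\|^\bullet_\rho=\sum_{d=0}^\infty\Bigl(\sum_{|\alpha|=d}|c_\alpha|^2\Bigr)^{1/2}\rho^d<\infty\ \ \forall\rho\in(0,r)\Bigr\},$$ with multiplication from $\mathfrak{F}_n$ and topology given by the norms $\|\cdot\|^\bullet_\rho$ ($0<\rho<r$). Popescu's algebra $\mathrm{Hol}(\mathcal{B}(\mathcal{H})^n_r)$: for $f=\sum_\alpha c_\alpha\zeta_\alpha\in\mathfrak{F}_n$ define the radius of convergence $R(f)\in[0,+\infty]$ by $\frac1{R(f)}=\limsup_{d\to\infty}\bigl(\sum_{|\alpha|=d}|c_\alpha|^2\bigr)^{1/(2d)}$.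 Then $\mathrm{Hol}(\mathcal{B}(\mathcal{H})^n_r)=\{f\in\mathfrak{F}_n:R(f)\ge r\}$, which is a subalgebra of $\mathfrak{F}_n$. For $T=(T_1,\dots,T_n)\in\mathcal{B}(\mathcal{H})^n$ ($n$-tuple of bounded operators on $\mathcal{H}$) put $\|T\|=\|\sum_{i=1}^nT_iT_i^*\|^{1/2}$. If $R(f)\ge r$ and $\|T\|<r$, the series $f(T)=\sum_{d=0}^\infty\bigl(\sum_{|\alpha|=d}c_\alpha T_\alpha\bigr)$ converges in $\mathcal{B}(\mathcal{H})$. The topology on $\mathrm{Hol}(\mathcal{B}(\mathcal{H})^n_r)$ is given by the seminorms $\|f\|^P_\rho=\sup\{\|f(T)\|:T\in\mathcal{B}(\mathcal{H})^n,\ \|T\|\le\rho\}$, $\rho\in(0,r)$. *)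

theory Defs
  imports "HOL-Analysis.Analysis"
begin

section \<open>Complex Hilbert spaces\<close>

class complex_inner = real_normed_vector +
  fixes scaleC :: "complex \<Rightarrow> 'a \<Rightarrow> 'a"  (infixr \<open>*\<^sub>C\<close> 75)
    and cinner :: "'a \<Rightarrow> 'a \<Rightarrow> complex"
  assumes scaleC_add_right: "c *\<^sub>C (x + y) = c *\<^sub>C x + c *\<^sub>C y"
    and scaleC_add_left: "(b + c) *\<^sub>C x = b *\<^sub>C x + c *\<^sub>C x"
    and scaleC_scaleC: "b *\<^sub>C (c *\<^sub>C x) = (b * c) *\<^sub>C x"
    and scaleC_of_real: "complex_of_real t *\<^sub>C x = t *\<^sub>R x"
    and cinner_commute: "cinner x y = cnj (cinner y x)"
    and cinner_add_left: "cinner (x + y) z = cinner x z + cinner y z"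
    and cinner_scaleC_left: "cinner (c *\<^sub>C x) y = c * cinner x y"
    and cinner_norm: "cinner x x = complex_of_real ((norm x)\<^sup>2)"

class complex_hilbert_space = complex_inner + complete_space

lemma vector_space_scaleC: "vector_space (scaleC :: complex \<Rightarrow> 'a \<Rightarrow> 'a::complex_inner)"
  by unfold_locales
    (simp_all add: scaleC_add_right scaleC_add_left scaleC_scaleC
      scaleC_of_real [of 1, simplified])

interpretation complex_vector: vector_space "scaleC :: complex \<Rightarrow> 'a \<Rightarrow> 'a::complex_inner"
  by (rule vector_space_scaleC)

definition infinite_dimensional :: "'h::complex_inner itself \<Rightarrow> bool" where
  "infinite_dimensional _ \<longleftrightarrow> \<not> (\<exists>B::'h set. finite B \<and> complex_vector.span B = UNIV)"

lemma norm_scaleC: "norm (c *\<^sub>C (x::'a::complex_inner)) = norm c * norm x"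
proof -
  have "complex_of_real ((norm (c *\<^sub>C x))\<^sup>2) = c * cnj c * cinner x x"
    by (metis cinner_norm cinner_commute cinner_scaleC_left complex_cnj_mult mult.assoc)
  also have "\<dots> = complex_of_real ((norm c * norm x)\<^sup>2)"
    by (simp add: cinner_norm complex_norm_square [symmetric] power_mult_distrib)
  finally have "(norm (c *\<^sub>C x))\<^sup>2 = (norm c * norm x)\<^sup>2"
    using of_real_eq_iff by blast
  then show ?thesis
    by (simp add: power2_eq_iff_nonneg)
qed

section \<open>Bounded operators\<close>

text \<open>The library type of bounded operators consists of the real-linear ones; the algebra
  \<open>B(H)\<close> is the following subset, with the operator norm and composition of that type.\<close>

definition bounded_ops :: "('h::complex_hilbert_space \<Rightarrow>\<^sub>L 'h) set" where
  "bounded_ops = {S. \<forall>c x. blinfun_apply S (c *\<^sub>C x) = c *\<^sub>C blinfun_apply S x}"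

lift_definition scale_op :: "complex \<Rightarrow> ('h::complex_inner \<Rightarrow>\<^sub>L 'h) \<Rightarrow> 'h \<Rightarrow>\<^sub>L 'h"
  is "\<lambda>c S x. c *\<^sub>C S x"
proof -
  fix c :: complex and S :: "'h \<Rightarrow> 'h"
  assume "bounded_linear S"
  moreover have "bounded_linear (\<lambda>x::'h. c *\<^sub>C x)"
  proof (rule bounded_linear_intro [where K = "norm c"])
    show "c *\<^sub>C (t *\<^sub>R x) = t *\<^sub>R (c *\<^sub>C x)" for t and x :: 'h
      by (simp add: scaleC_of_real [symmetric] scaleC_scaleC mult.commute)
  qed (simp_all add: scaleC_add_right norm_scaleC mult.commute)
  ultimately show "bounded_linear (\<lambda>x. c *\<^sub>C S x)"
    using bounded_linear_compose by blast
qed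

definition adjoint_op :: "('h::complex_hilbert_space \<Rightarrow>\<^sub>L 'h) \<Rightarrow> 'h \<Rightarrow>\<^sub>L 'h" where
  "adjoint_op S = (THE S'. \<forall>x y. cinner (blinfun_apply S x) y = cinner x (blinfun_apply S' y))"

text \<open>An \<open>n\<close>-tuple of operators is a function of which only the values on \<open>{1..n}\<close> matter.\<close>

definition tuple_norm :: "nat \<Rightarrow> (nat \<Rightarrow> ('h::complex_hilbert_space \<Rightarrow>\<^sub>L 'h)) \<Rightarrow> real" where
  "tuple_norm n T = sqrt (norm (\<Sum>i=1..n. T i o\<^sub>L adjoint_op (T i)))"

definition word_op :: "(nat \<Rightarrow> ('h::complex_hilbert_space \<Rightarrow>\<^sub>L 'h)) \<Rightarrow> nat list \<Rightarrow> 'h \<Rightarrow>\<^sub>L 'h" where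
  "word_op T \<alpha> = foldr (\<lambda>i S. T i o\<^sub>L S) \<alpha> id_blinfun"

section \<open>Formal series in free variables\<close>

definition words :: "nat \<Rightarrow> nat \<Rightarrow> nat list set" where
  "words n d = {\<alpha>. length \<alpha> = d \<and> set \<alpha> \<subseteq> {1..n}}"

text \<open>A formal series is given by its coefficients, extended by \<open>0\<close> outside the words in
  \<open>{1..n}\<close> so that equality of series is equality of functions.\<close>

type_synonym series = "nat list \<Rightarrow> complex"

definition formal_series :: "nat \<Rightarrow> series set" where
  "formal_series n = {f. \<forall>\<alpha>. \<alpha> \<notin> (\<Union>d. words n d) \<longrightarrow> f \<alpha> = 0}"

definition series_one :: series where
  "series_one = (\<lambda>\<alpha>. if \<alpha> = [] then 1 else 0)"

definition series_add :: "series \<Rightarrow> series \<Rightarrow> series" where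
  "series_add f g = (\<lambda>\<alpha>. f \<alpha> + g \<alpha>)"

definition series_diff :: "series \<Rightarrow> series \<Rightarrow> series" where
  "series_diff f g = (\<lambda>\<alpha>. f \<alpha> - g \<alpha>)"

definition series_scale :: "complex \<Rightarrow> series \<Rightarrow> series" where
  "series_scale c f = (\<lambda>\<alpha>. c * f \<alpha>)"

text \<open>Since \<open>\<zeta>\<^sub>\<beta> \<zeta>\<^sub>\<gamma> = \<zeta>\<^bsub>\<beta>\<gamma>\<^esub>\<close>, the coefficient of a product at \<open>\<alpha>\<close> is a sum over all
  factorizations of \<open>\<alpha>\<close> as a concatenation.\<close>

definition series_mult :: "series \<Rightarrow> series \<Rightarrow> series" where
  "series_mult f g = (\<lambda>\<alpha>. \<Sum>(\<beta>, \<gamma>) \<in> {(\<beta>, \<gamma>). \<beta> @ \<gamma> = \<alpha>}. f \<beta> * g \<gamma>)"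

definition subalgebra_of_series :: "nat \<Rightarrow> series set \<Rightarrow> bool" where
  "subalgebra_of_series n A \<longleftrightarrow>
     A \<subseteq> formal_series n \<and> series_one \<in> A \<and>
     (\<forall>f\<in>A. \<forall>g\<in>A. series_add f g \<in> A) \<and>
     (\<forall>c. \<forall>f\<in>A. series_scale c f \<in> A) \<and>
     (\<forall>f\<in>A. \<forall>g\<in>A. series_mult f g \<in> A)"

text \<open>The topology on \<open>X\<close> defined by the family of seminorms \<open>p \<rho>\<close> for \<open>0 < \<rho> < r\<close>: the coarsest
  one in which all seminorm balls are open. The seminorms are \<open>ennreal\<close>-valued so that their
  definition as sums and suprema needs no prior proof of finiteness.\<close>

definition seminorm_topology ::
    "ereal \<Rightarrow> (real \<Rightarrow> series \<Rightarrow> ennreal) \<Rightarrow> series set \<Rightarrow> series topology" where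
  "seminorm_topology r p X = topology_generated_by
     {{g \<in> X. p \<rho> (series_diff g f) < ennreal \<epsilon>} | f \<rho> \<epsilon>.
        f \<in> X \<and> 0 < \<rho> \<and> ereal \<rho> < r \<and> 0 < \<epsilon>}"

section \<open>The free ball algebra\<close>

definition free_ball_norm :: "nat \<Rightarrow> real \<Rightarrow> series \<Rightarrow> ennreal" where
  "free_ball_norm n \<rho> f = (\<Sum>d. ennreal (sqrt (\<Sum>\<alpha>\<in>words n d. (cmod (f \<alpha>))\<^sup>2) * \<rho> ^ d))"

definition free_ball_algebra :: "nat \<Rightarrow> ereal \<Rightarrow> series set" where
  "free_ball_algebra n r =
     {f \<in> formal_series n. \<forall>\<rho>. 0 < \<rho> \<and> ereal \<rho> < r \<longrightarrow> free_ball_norm n \<rho> f < \<infinity>}"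

definition free_ball_topology :: "nat \<Rightarrow> ereal \<Rightarrow> series topology" where
  "free_ball_topology n r = seminorm_topology r (free_ball_norm n) (free_ball_algebra n r)"

section \<open>Popescu's algebra\<close>

text \<open>In \<open>ereal\<close>, \<open>inverse 0 = \<infinity>\<close> and \<open>inverse \<infinity> = 0\<close>.\<close>

definition radius_of_convergence :: "nat \<Rightarrow> series \<Rightarrow> ereal" where
  "radius_of_convergence n f =
     inverse (limsup (\<lambda>d. ereal ((\<Sum>\<alpha>\<in>words n d. (cmod (f \<alpha>))\<^sup>2) powr (1 / (2 * real d)))))"

definition popescu_algebra :: "nat \<Rightarrow> ereal \<Rightarrow> series set" where
  "popescu_algebra n r = {f \<in> formal_series n. r \<le> radius_of_convergence n f}"

definition series_eval ::
    "nat \<Rightarrow> series \<Rightarrow> (nat \<Rightarrow> ('h::complex_hilbert_space \<Rightarrow>\<^sub>L 'h)) \<Rightarrow> 'h \<Rightarrow>\<^sub>L 'h" where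
  "series_eval n f T = (\<Sum>d. \<Sum>\<alpha>\<in>words n d. scale_op (f \<alpha>) (word_op T \<alpha>))"

definition popescu_seminorm ::
    "'h::complex_hilbert_space itself \<Rightarrow> nat \<Rightarrow> real \<Rightarrow> series \<Rightarrow> ennreal" where
  "popescu_seminorm _ n \<rho> f =
     (SUP T \<in> {T :: nat \<Rightarrow> ('h \<Rightarrow>\<^sub>L 'h). (\<forall>i\<in>{1..n}. T i \<in> bounded_ops) \<and> tuple_norm n T \<le> \<rho>}.
        ennreal (norm (series_eval n f T)))"

definition popescu_topology ::
    "'h::complex_hilbert_space itself \<Rightarrow> nat \<Rightarrow> ereal \<Rightarrow> series topology" where
  "popescu_topology H n r = seminorm_topology r (popescu_seminorm H n) (popescu_algebra n r)"

end

theory Submission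
  imports Defs
begin

text \<open>Let \<open>A\<^sub>d\<close> be the \<open>\<ell>\<^sup>2\<close>-norm of the coefficients of \<open>f\<close> of degree \<open>d\<close>. By the root test both
  algebras consist of the series for which \<open>\<Sum>A\<^sub>d \<rho>\<^sup>d\<close> converges for all \<open>\<rho> < r\<close>, and \<open>A\<close> is
  submultiplicative under the Cauchy product. A tuple has norm at most \<open>\<rho>\<close> iff the row
  operator \<open>(x\<^sub>1, \<dots>, x\<^sub>n) \<mapsto> \<Sum>T\<^sub>i x\<^sub>i\<close> does; iterating this bounds the degree \<open>d\<close> part of \<open>f(T)\<close> by
  \<open>A\<^sub>d \<rho>\<^sup>d\<close>. Conversely, for the creation operators of the full Fock space scaled by \<open>\<rho>'\<close>, the
  degree \<open>N\<close> component of \<open>f(T)\<Omega>\<close> has norm \<open>A\<^sub>N \<rho>'\<^sup>N\<close>. Truncating the Fock space at degree \<open>N\<close>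
  makes it finite-dimensional, so that it embeds into any infinite-dimensional \<open>H\<close>. Hence \<open>A\<^sub>N \<rho>'\<^sup>N\<close>
  is at most Popescu's seminorm at \<open>\<rho>'\<close>, and summing a geometric series in \<open>\<rho>/\<rho>'\<close> bounds the
  free ball norm at \<open>\<rho> < \<rho>'\<close>.\<close>

section \<open>Inner products and adjoints\<close>

\<comment> \<open>Completeness of the Hilbert space passes to its \<open>blinfun\<close> type, so
  that absolutely convergent series of operators converge.\<close>
subclass (in complex_hilbert_space) banach ..

lemma cinner_zero_left [simp]: "cinner 0 (y::'a::complex_inner) = 0"
  using cinner_add_left [of 0 0 y] by simp

lemma cinner_zero_right [simp]: "cinner (x::'a::complex_inner) 0 = 0"
  by (subst cinner_commute) simp

lemma cinner_add_right: "cinner (x::'a::complex_inner) (y + z) = cinner x y + cinner x z"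
  by (metis cinner_add_left cinner_commute complex_cnj_add)

lemma cinner_scaleC_right: "cinner (x::'a::complex_inner) (c *\<^sub>C y) = cnj c * cinner x y"
  by (metis cinner_scaleC_left cinner_commute complex_cnj_mult)

lemma cinner_minus_right: "cinner (x::'a::complex_inner) (- y) = - cinner x y"
  using cinner_add_right [of x y "- y"] by (simp add: eq_neg_iff_add_eq_0 add.commute)

lemma cinner_diff_right: "cinner (x::'a::complex_inner) (y - z) = cinner x y - cinner x z"
  using cinner_add_right [of x y "- z"] by (simp add: cinner_minus_right)

lemma cinner_sum_left: "cinner (\<Sum>i\<in>I. f i) (y::'a::complex_inner) = (\<Sum>i\<in>I. cinner (f i) y)"
  by (induction I rule: infinite_finite_induct) (simp_all add: cinner_add_left)

lemma cinner_sum_right: "cinner (x::'a::complex_inner) (\<Sum>i\<in>I. f i) = (\<Sum>i\<in>I. cinner x (f i))"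
  by (induction I rule: infinite_finite_induct) (simp_all add: cinner_add_right)

lemma cinner_scaleR_left: "cinner (t *\<^sub>R x) (y::'a::complex_inner) = t *\<^sub>R cinner x y"
  by (simp add: scaleC_of_real [symmetric] cinner_scaleC_left scaleR_conv_of_real)

lemma Re_cinner_commute: "Re (cinner y x) = Re (cinner x (y::'a::complex_inner))"
  by (subst cinner_commute) simp

lemma power2_norm_eq_cinner: "(norm (x::'a::complex_inner))\<^sup>2 = Re (cinner x x)"
  by (simp add: cinner_norm)

lemma power2_norm_add:
  "(norm (x + y::'a::complex_inner))\<^sup>2 = (norm x)\<^sup>2 + 2 * Re (cinner x y) + (norm y)\<^sup>2"
  by (simp add: power2_norm_eq_cinner cinner_add_left cinner_add_right Re_cinner_commute [of y x])

lemma power2_norm_diff: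
  "(norm (x - y::'a::complex_inner))\<^sup>2 = (norm x)\<^sup>2 - 2 * Re (cinner x y) + (norm y)\<^sup>2"
  using power2_norm_add [of x "- y"] by (simp add: cinner_minus_right)

lemma cinner_Cauchy_Schwarz: "cmod (cinner x (y::'a::complex_inner)) \<le> norm x * norm y"
proof (cases "y = 0")
  case False
  \<comment> \<open>\<open>c *\<^sub>C y\<close> is the orthogonal projection of \<open>x\<close>
    onto the line through \<open>y\<close>; the inequality says that the remainder has nonnegative
    squared norm.\<close>
  define c where "c = cinner x y / (norm y)\<^sup>2"
  have "0 \<le> (norm (x - c *\<^sub>C y))\<^sup>2" by simp
  also have "\<dots> = (norm x)\<^sup>2 - 2 * Re (cnj c * cinner x y) + (cmod c)\<^sup>2 * (norm y)\<^sup>2"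
    by (simp add: power2_norm_diff cinner_scaleC_right norm_scaleC power_mult_distrib)
  also have "cnj c * cinner x y = complex_of_real ((cmod (cinner x y))\<^sup>2 / (norm y)\<^sup>2)"
    using complex_norm_square [of "cinner x y"] by (simp add: c_def mult.commute)
  also have "(cmod c)\<^sup>2 * (norm y)\<^sup>2 = (cmod (cinner x y))\<^sup>2 / (norm y)\<^sup>2"
    using False by (simp add: c_def norm_divide norm_power power_divide divide_simps)
  finally have "(cmod (cinner x y))\<^sup>2 / (norm y)\<^sup>2 \<le> (norm x)\<^sup>2"
    by (simp add: norm_power)
  then have "(cmod (cinner x y))\<^sup>2 \<le> (norm x * norm y)\<^sup>2"
    using False by (simp add: field_simps power_mult_distrib)
  then show ?thesis by (rule power2_le_imp_le) simp
qed simp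

text \<open>The representing vector is the minimizer of \<open>\<parallel>x\<parallel>\<^sup>2 - 2 Re (\<phi> x)\<close>.\<close>

lemma Riesz_representation:
  fixes \<phi> :: "'h::complex_hilbert_space \<Rightarrow> complex"
  assumes lin: "bounded_linear \<phi>" and hom: "\<And>c x. \<phi> (c *\<^sub>C x) = c * \<phi> x"
  shows "\<exists>z. \<forall>x. \<phi> x = cinner x z"
proof -
  interpret bounded_linear \<phi> by (rule lin)
  obtain K where K: "\<And>x. cmod (\<phi> x) \<le> norm x * K" using bounded by blast
  define J where "J x = (norm x)\<^sup>2 - 2 * Re (\<phi> x)" for x
  have lower: "- K\<^sup>2 \<le> J x" for x
  proof -
    have "Re (\<phi> x) \<le> norm x * K" using K [of x] complex_Re_le_cmod [of "\<phi> x"] by linarith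
    moreover have "0 \<le> (norm x - K)\<^sup>2" by simp
    ultimately show ?thesis by (simp add: J_def power2_diff)
  qed
  define m where "m = Inf (range J)"
  have bdd: "bdd_below (range J)" by (rule bdd_belowI [of _ "- K\<^sup>2"]) (use lower in auto)
  have m_le: "m \<le> J x" for x unfolding m_def using bdd by (simp add: cInf_lower)
  have "\<exists>x. J x < m + 1 / real (Suc k)" for k
    using cInf_lessD [of "range J" "m + 1 / real (Suc k)"] by (auto simp: m_def)
  then obtain x where x: "\<And>k. J (x k) < m + 1 / real (Suc k)" by metis
  \<comment> \<open>Parallelogram law: \<open>J\<close> at the midpoint of \<open>u\<close> and
    \<open>v\<close> is still at least \<open>m\<close>, so two near-minimizers must be close. This
    makes a minimizing sequence Cauchy.\<close>
  have close: "(norm (u - v))\<^sup>2 \<le> 2 * (J u - m) + 2 * (J v - m)" for u v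
  proof -
    have "J ((1/2) *\<^sub>R (u + v)) = (norm (u + v))\<^sup>2 / 4 - Re (\<phi> u) - Re (\<phi> v)"
      by (simp add: J_def scaleR add power_divide del: scaleR_half_double) (simp add: field_simps)
    with m_le [of "(1/2) *\<^sub>R (u + v)"]
    have "m \<le> (norm (u + v))\<^sup>2 / 4 - Re (\<phi> u) - Re (\<phi> v)" by linarith
    then show ?thesis
      using power2_norm_add [of u v] power2_norm_diff [of u v] unfolding J_def by argo
  qed
  have "Cauchy x"
  proof (rule metric_CauchyI)
    fix e :: real assume "0 < e"
    then obtain N where N: "1 / real (Suc N) < e\<^sup>2 / 4"
      using nat_approx_posE [of "e\<^sup>2 / 4"] by (metis zero_less_power zero_less_divide_iff zero_less_numeral)
    have "dist (x i) (x j) < e" if "N \<le> i" "N \<le> j" for i j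
    proof -
      have "1 / real (Suc i) \<le> 1 / real (Suc N)" "1 / real (Suc j) \<le> 1 / real (Suc N)"
        using that by (simp_all add: frac_le)
      then have "(norm (x i - x j))\<^sup>2 < e\<^sup>2"
        using close [of "x i" "x j"] x [of i] x [of j] N by argo
      then show ?thesis
        using \<open>0 < e\<close> by (simp add: dist_norm power2_less_imp_less)
    qed
    then show "\<exists>N. \<forall>i\<ge>N. \<forall>j\<ge>N. dist (x i) (x j) < e" by blast
  qed
  then obtain z where z: "x \<longlonglongrightarrow> z" using Cauchy_convergent convergent_def by blast
  have "(\<lambda>k. J (x k)) \<longlonglongrightarrow> J z"
    unfolding J_def by (intro tendsto_intros z tendsto)
  moreover have "(\<lambda>k. m + 1 / real (Suc k)) \<longlonglongrightarrow> m"
    using tendsto_add [OF tendsto_const LIMSEQ_inverse_real_of_nat, of m] by (simp add: field_simps)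
  ultimately have "J z \<le> m"
    by (rule LIMSEQ_le) (use x less_imp_le in blast)
  then have min: "J z \<le> J y" for y using m_le [of y] by linarith
  have re: "Re (\<phi> h) = Re (cinner h z)" for h
  proof -
    \<comment> \<open>\<open>2 * a\<close> is the derivative of \<open>J\<close> at the minimizer
      \<open>z\<close> in direction \<open>h\<close>, so it has to vanish.\<close>
    define a where "a = Re (cinner z h) - Re (\<phi> h)"
    have quad: "0 \<le> 2 * t * a + t\<^sup>2 * (norm h)\<^sup>2" for t :: real
    proof -
      have "Re (cinner z (t *\<^sub>R h)) = t * Re (cinner z h)"
        by (simp add: scaleC_of_real [symmetric] cinner_scaleC_right)
      then show ?thesis
        using min [of "z + t *\<^sub>R h"] by (simp add: J_def power2_norm_add add scaleR a_def power_mult_distrib algebra_simps)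
    qed
    have "a = 0"
    proof (rule ccontr)
      assume "a \<noteq> 0"
      \<comment> \<open>The choice \<open>t = - a / s\<close> makes the quadratic negative unless
        \<open>a = 0\<close>; the summand 1 keeps \<open>s\<close> positive when
        \<open>h = 0\<close>.\<close>
      define s where "s = 1 + (norm h)\<^sup>2"
      have "s > 0" unfolding s_def by (simp add: add_pos_nonneg)
      have "0 \<le> 2 * (- a / s) * a + (- a / s)\<^sup>2 * (norm h)\<^sup>2" by (rule quad)
      also have "\<dots> \<le> 2 * (- a / s) * a + (- a / s)\<^sup>2 * s"
        by (intro add_left_mono mult_left_mono) (simp_all add: s_def)
      also have "\<dots> = - a\<^sup>2 / s" using \<open>s > 0\<close> by (simp add: field_simps power2_eq_square)
      finally show False using \<open>s > 0\<close> \<open>a \<noteq> 0\<close> by (simp add: divide_simps)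
    qed
    then show ?thesis by (simp add: a_def Re_cinner_commute [of z h])
  qed
  \<comment> \<open>Real parts at \<open>\<i> *\<^sub>C h\<close> give the imaginary parts at
    \<open>h\<close>, as both sides are complex-linear.\<close>
  have "\<phi> h = cinner h z" for h
    using re [of h] re [of "\<i> *\<^sub>C h"] by (simp add: hom cinner_scaleC_left complex_eq_iff)
  then show ?thesis by blast
qed

text \<open>For fixed \<open>y\<close> the functional sending \<open>x\<close> to
  \<open>cinner (S x) y\<close> is complex-linear because \<open>S\<close> is, so Riesz supplies the
  value of the adjoint at \<open>y\<close>. Linearity follows since the inner product separates
  points.\<close>

lemma adjoint_op_exists:
  fixes S :: "'h::complex_hilbert_space \<Rightarrow>\<^sub>L 'h"
  assumes S: "S \<in> bounded_ops"
  shows "\<exists>S'. \<forall>x y. cinner (blinfun_apply S x) y = cinner x (blinfun_apply S' y)"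
proof -
  have "\<exists>z. \<forall>x. cinner (blinfun_apply S x) y = cinner x z" for y
  proof (rule Riesz_representation)
    show "bounded_linear (\<lambda>x. cinner (blinfun_apply S x) y)"
    proof (rule bounded_linear_intro [where K = "norm S * norm y"])
      show "cmod (cinner (blinfun_apply S x) y) \<le> norm x * (norm S * norm y)" for x
        using cinner_Cauchy_Schwarz [of "blinfun_apply S x" y] norm_blinfun [of S x]
        by (smt (verit, best) mult.assoc mult.commute mult_right_mono norm_ge_zero)
    qed (simp_all add: blinfun.add_right blinfun.scaleR_right cinner_add_left cinner_scaleR_left)
  qed (use S in \<open>simp add: bounded_ops_def cinner_scaleC_left\<close>)
  then obtain A where A: "\<And>x y. cinner (blinfun_apply S x) y = cinner x (A y)" by metis
  have eqI: "u = v" if "\<And>x. cinner x u = cinner x v" for u v :: 'h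
    using that [of "u - v"] power2_norm_eq_cinner [of "u - v"] by (simp add: cinner_diff_right)
  have "bounded_linear A"
  proof (rule bounded_linear_intro [where K = "norm S"])
    show "A (x + y) = A x + A y" for x y
      by (rule eqI) (simp add: A [symmetric] cinner_add_right)
    show "A (t *\<^sub>R y) = t *\<^sub>R A y" for t y
      by (rule eqI) (simp add: A [symmetric] cinner_scaleC_right flip: scaleC_of_real)
    show "norm (A y) \<le> norm y * norm S" for y
    proof -
      \<comment> \<open>Testing the adjoint relation at \<open>x = A y\<close> bounds the square of
        \<open>norm (A y)\<close> by a multiple of \<open>norm (A y)\<close>, and one factor
        cancels.\<close>
      have "(norm (A y))\<^sup>2 = Re (cinner (blinfun_apply S (A y)) y)"
        by (simp add: power2_norm_eq_cinner A)
      also have "\<dots> \<le> norm (blinfun_apply S (A y)) * norm y"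
        using cinner_Cauchy_Schwarz complex_Re_le_cmod order_trans by blast
      also have "\<dots> \<le> norm S * norm (A y) * norm y"
        by (intro mult_right_mono norm_blinfun) simp
      finally show ?thesis
        by (cases "A y = 0") (simp_all add: power2_eq_square mult_ac)
    qed
  qed
  then show ?thesis using A by (intro exI [of _ "Blinfun A"]) (simp add: bounded_linear_Blinfun_apply)
qed

text \<open>The \<open>THE\<close> in \<open>adjoint_op\<close> denotes the adjoint: existence comes
  from Riesz, uniqueness from testing with the difference of two candidates.\<close>

lemma cinner_adjoint_op:
  assumes S: "S \<in> bounded_ops"
  shows "cinner (blinfun_apply S x) y = cinner x (blinfun_apply (adjoint_op S) y)"
proof -
  have "\<exists>!S'. \<forall>x y. cinner (blinfun_apply S x) y = cinner x (blinfun_apply S' y)"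
  proof (rule ex_ex1I [OF adjoint_op_exists [OF S]], rule blinfun_eqI)
    fix P Q y
    assume "\<forall>x y. cinner (blinfun_apply S x) y = cinner x (blinfun_apply P y)"
      and "\<forall>x y. cinner (blinfun_apply S x) y = cinner x (blinfun_apply Q y)"
    then have "cinner (blinfun_apply P y - blinfun_apply Q y) (blinfun_apply P y - blinfun_apply Q y) = 0"
      by (simp add: cinner_diff_right)
    then show "blinfun_apply P y = blinfun_apply Q y"
      using power2_norm_eq_cinner [of "blinfun_apply P y - blinfun_apply Q y"] by simp
  qed
  from theI' [OF this] show ?thesis unfolding adjoint_op_def by blast
qed


section \<open>Row operators\<close>

lemma tuple_norm_nonneg: "0 \<le> tuple_norm n T"
  by (simp add: tuple_norm_def)

text \<open>The adjoint of the row is the column of the adjoints. This identity links that column to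
  the operator whose norm defines \<open>tuple_norm\<close>.\<close>

lemma sum_adjoint_norm:
  assumes "\<forall>i\<in>{1..n}. T i \<in> bounded_ops"
  shows "(\<Sum>i=1..n. (norm (blinfun_apply (adjoint_op (T i)) y))\<^sup>2)
    = Re (cinner (blinfun_apply (\<Sum>i=1..n. T i o\<^sub>L adjoint_op (T i)) y) y)"
  using assms
  by (simp add: blinfun.sum_left cinner_sum_left cinner_adjoint_op power2_norm_eq_cinner)

lemma cinner_row:
  assumes "\<forall>i\<in>{1..n}. T i \<in> bounded_ops"
  shows "cmod (cinner (\<Sum>i=1..n. blinfun_apply (T i) (x i)) y)
    \<le> L2_set (\<lambda>i. norm (x i)) {1..n}
      * L2_set (\<lambda>i. norm (blinfun_apply (adjoint_op (T i)) y)) {1..n}"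
proof -
  have "cinner (\<Sum>i=1..n. blinfun_apply (T i) (x i)) y
    = (\<Sum>i=1..n. cinner (x i) (blinfun_apply (adjoint_op (T i)) y))"
    using assms by (simp add: cinner_sum_left cinner_adjoint_op)
  also have "cmod \<dots> \<le> (\<Sum>i=1..n. norm (x i) * norm (blinfun_apply (adjoint_op (T i)) y))"
    by (intro order_trans [OF norm_sum] sum_mono cinner_Cauchy_Schwarz)
  also have "\<dots> \<le> L2_set (\<lambda>i. norm (x i)) {1..n}
      * L2_set (\<lambda>i. norm (blinfun_apply (adjoint_op (T i)) y)) {1..n}"
    using L2_set_mult_ineq [of "\<lambda>i. norm (x i)" "\<lambda>i. norm (blinfun_apply (adjoint_op (T i)) y)" "{1..n}"]
    by simp
  finally show ?thesis .
qed

text \<open>Pairing the image \<open>y\<close> with itself moves the row onto the column of adjoints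
  at \<open>y\<close>. The square of the norm of that column is a value of the quadratic form of
  \<open>M\<close>, hence at most \<open>norm M\<close> times the square of
  \<open>norm y\<close>.\<close>

lemma norm_row_le:
  fixes T :: "nat \<Rightarrow> ('h::complex_hilbert_space \<Rightarrow>\<^sub>L 'h)"
  assumes "\<forall>i\<in>{1..n}. T i \<in> bounded_ops"
  shows "norm (\<Sum>i=1..n. blinfun_apply (T i) (x i)) \<le> tuple_norm n T * L2_set (\<lambda>i. norm (x i)) {1..n}"
proof -
  define y where "y = (\<Sum>i=1..n. blinfun_apply (T i) (x i))"
  define M where "M = (\<Sum>i=1..n. T i o\<^sub>L adjoint_op (T i))"
  have "(\<Sum>i=1..n. (norm (blinfun_apply (adjoint_op (T i)) y))\<^sup>2) \<le> norm (blinfun_apply M y) * norm y"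
    unfolding sum_adjoint_norm [OF assms] M_def
    using cinner_Cauchy_Schwarz complex_Re_le_cmod order_trans by blast
  also have "\<dots> \<le> norm M * (norm y)\<^sup>2"
    using mult_right_mono [OF norm_blinfun [of M y], of "norm y"] by (simp add: power2_eq_square mult_ac)
  finally have *: "L2_set (\<lambda>i. norm (blinfun_apply (adjoint_op (T i)) y)) {1..n} \<le> tuple_norm n T * norm y"
    unfolding L2_set_def tuple_norm_def M_def [symmetric]
    by (metis real_sqrt_le_mono real_sqrt_mult real_sqrt_abs abs_norm_cancel)
  have "norm y * norm y = cmod (cinner y y)"
    by (simp add: cinner_norm norm_power power2_eq_square norm_mult)
  also have "\<dots> \<le> L2_set (\<lambda>i. norm (x i)) {1..n}
      * L2_set (\<lambda>i. norm (blinfun_apply (adjoint_op (T i)) y)) {1..n}"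
    unfolding y_def by (rule cinner_row [OF assms])
  also have "\<dots> \<le> L2_set (\<lambda>i. norm (x i)) {1..n} * (tuple_norm n T * norm y)"
    by (intro mult_left_mono *) simp
  finally have "norm y \<le> tuple_norm n T * L2_set (\<lambda>i. norm (x i)) {1..n}"
    by (cases "norm y = 0") (simp_all add: tuple_norm_nonneg mult_ac)
  then show ?thesis by (simp add: y_def)
qed

text \<open>Converse of the row bound, tested on the column of adjoints at \<open>y\<close>. It
  allows \<open>tuple_norm\<close> to be estimated without computing any adjoint.\<close>

lemma tuple_norm_leI:
  fixes T :: "nat \<Rightarrow> ('h::complex_hilbert_space \<Rightarrow>\<^sub>L 'h)"
  assumes T: "\<forall>i\<in>{1..n}. T i \<in> bounded_ops" and "0 \<le> K"
    and row: "\<And>x. norm (\<Sum>i=1..n. blinfun_apply (T i) (x i)) \<le> K * L2_set (\<lambda>i. norm (x i)) {1..n}"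
  shows "tuple_norm n T \<le> K"
proof -
  define M where "M = (\<Sum>i=1..n. T i o\<^sub>L adjoint_op (T i))"
  have "norm (blinfun_apply M y) \<le> K\<^sup>2 * norm y" for y
  proof -
    let ?x = "\<lambda>i. blinfun_apply (adjoint_op (T i)) y"
    have "norm (blinfun_apply M y) \<le> K * L2_set (\<lambda>i. norm (?x i)) {1..n}"
      using row [of ?x] by (simp add: M_def blinfun.sum_left)
    then have "(norm (blinfun_apply M y))\<^sup>2 \<le> K\<^sup>2 * (L2_set (\<lambda>i. norm (?x i)) {1..n})\<^sup>2"
      by (metis power_mono norm_ge_zero power_mult_distrib)
    also have "(L2_set (\<lambda>i. norm (?x i)) {1..n})\<^sup>2 = Re (cinner (blinfun_apply M y) y)"
      unfolding L2_set_def M_def sum_adjoint_norm [OF T, symmetric] by (simp add: sum_nonneg)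
    also have "K\<^sup>2 * Re (cinner (blinfun_apply M y) y) \<le> K\<^sup>2 * (norm (blinfun_apply M y) * norm y)"
      using cinner_Cauchy_Schwarz complex_Re_le_cmod order_trans by (intro mult_left_mono) (blast, simp)
    finally show ?thesis
      by (cases "blinfun_apply M y = 0") (simp_all add: power2_eq_square mult_ac \<open>0 \<le> K\<close>)
  qed
  then have "norm M \<le> K\<^sup>2" by (intro norm_blinfun_bound) simp_all
  then show ?thesis
    using \<open>0 \<le> K\<close> by (simp add: tuple_norm_def M_def real_le_lsqrt)
qed

section \<open>Evaluation of homogeneous components\<close>

text \<open>The form with \<open>L2_set\<close> gives access to Minkowski's inequality; unfolding it
  yields the square root in \<open>free_ball_norm\<close>.\<close>

definition coeff_norm :: "nat \<Rightarrow> series \<Rightarrow> nat \<Rightarrow> real" where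
  "coeff_norm n f d = L2_set (\<lambda>\<alpha>. cmod (f \<alpha>)) (words n d)"

lemma finite_words [simp]: "finite (words n d)"
  using finite_lists_length_eq [of "{1..n}" d] by (simp add: words_def conj_commute)

lemma words_0: "words n 0 = {[]}"
  by (auto simp: words_def)

text \<open>A nonempty word is a first letter followed by a word. Splitting at the front matches the
  recursion of \<open>word_op\<close>, which peels off the outermost operator.\<close>

lemma sum_words_Suc: "(\<Sum>\<alpha>\<in>words n (Suc d). g \<alpha>) = (\<Sum>i=1..n. \<Sum>\<alpha>\<in>words n d. g (i # \<alpha>))"
proof -
  have "(\<Sum>\<alpha>\<in>words n (Suc d). g \<alpha>) = (\<Sum>(i, \<alpha>)\<in>{1..n} \<times> words n d. g (i # \<alpha>))"
    by (rule sum.reindex_bij_witness [of _ "\<lambda>(i, \<alpha>). i # \<alpha>" "\<lambda>\<alpha>. (hd \<alpha>, tl \<alpha>)"])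
      (auto simp: words_def length_Suc_conv)
  then show ?thesis by (simp add: sum.cartesian_product)
qed

lemma coeff_norm_nonneg [simp]: "0 \<le> coeff_norm n f d"
  by (simp add: coeff_norm_def)

lemma word_op_Nil [simp]: "word_op T [] = id_blinfun"
  by (simp add: word_op_def)

lemma word_op_Cons [simp]: "word_op T (i # \<alpha>) = T i o\<^sub>L word_op T \<alpha>"
  by (simp add: word_op_def)

text \<open>The row of all words of length \<open>d\<close> is a \<open>d\<close>-fold iterate of
  the row \<open>T\<close>. A separate vector for each word is what the induction requires: after
  the first letter \<open>i\<close> is removed, the vectors still depend on
  \<open>i\<close>.\<close>

lemma norm_sum_word_op_le:
  fixes T :: "nat \<Rightarrow> ('h::complex_hilbert_space \<Rightarrow>\<^sub>L 'h)"
  assumes T: "\<forall>i\<in>{1..n}. T i \<in> bounded_ops"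
  shows "norm (\<Sum>\<alpha>\<in>words n d. blinfun_apply (word_op T \<alpha>) (x \<alpha>))
    \<le> tuple_norm n T ^ d * L2_set (\<lambda>\<alpha>. norm (x \<alpha>)) (words n d)"
proof (induction d arbitrary: x)
  case (Suc d)
  let ?y = "\<lambda>i. \<Sum>\<alpha>\<in>words n d. blinfun_apply (word_op T \<alpha>) (x (i # \<alpha>))"
  let ?L = "\<lambda>i. L2_set (\<lambda>\<alpha>. norm (x (i # \<alpha>))) (words n d)"
  have "(\<Sum>\<alpha>\<in>words n (Suc d). blinfun_apply (word_op T \<alpha>) (x \<alpha>)) = (\<Sum>i=1..n. blinfun_apply (T i) (?y i))"
    by (simp add: sum_words_Suc blinfun.sum_right)
  also have "norm \<dots> \<le> tuple_norm n T * L2_set (\<lambda>i. norm (?y i)) {1..n}"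
    by (rule norm_row_le [OF T])
  also have "\<dots> \<le> tuple_norm n T * L2_set (\<lambda>i. tuple_norm n T ^ d * ?L i) {1..n}"
    by (intro mult_left_mono L2_set_mono Suc.IH tuple_norm_nonneg norm_ge_zero)
  also have "\<dots> = tuple_norm n T ^ Suc d * L2_set ?L {1..n}"
    by (simp add: L2_set_right_distrib [symmetric] tuple_norm_nonneg)
  also have "L2_set ?L {1..n} = L2_set (\<lambda>\<alpha>. norm (x \<alpha>)) (words n (Suc d))"
    by (simp add: L2_set_def sum_words_Suc sum_nonneg)
  finally show ?case .
qed (simp add: words_0)

lemma word_op_scaleC:
  assumes "\<forall>i\<in>{1..n}. T i \<in> bounded_ops" and "set \<alpha> \<subseteq> {1..n}"
  shows "blinfun_apply (word_op T \<alpha>) (c *\<^sub>C x) = c *\<^sub>C blinfun_apply (word_op T \<alpha>) x"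
  using assms(2) by (induction \<alpha>) (use assms(1) in \<open>simp_all add: bounded_ops_def\<close>)

text \<open>By complex linearity each coefficient can be moved onto the vector. The word row then
  acts on the family \<open>f \<alpha> *\<^sub>C x\<close>, whose \<ell>2-norm is
  \<open>coeff_norm n f d * norm x\<close>.\<close>

lemma norm_homogeneous_eval_le:
  fixes T :: "nat \<Rightarrow> ('h::complex_hilbert_space \<Rightarrow>\<^sub>L 'h)"
  assumes T: "\<forall>i\<in>{1..n}. T i \<in> bounded_ops" and "tuple_norm n T \<le> \<rho>"
  shows "norm (\<Sum>\<alpha>\<in>words n d. scale_op (f \<alpha>) (word_op T \<alpha>)) \<le> coeff_norm n f d * \<rho> ^ d"
proof (rule norm_blinfun_bound)
  show "0 \<le> coeff_norm n f d * \<rho> ^ d"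
    using assms(2) tuple_norm_nonneg [of n T] by simp
  fix x :: 'h
  have "blinfun_apply (\<Sum>\<alpha>\<in>words n d. scale_op (f \<alpha>) (word_op T \<alpha>)) x
    = (\<Sum>\<alpha>\<in>words n d. blinfun_apply (word_op T \<alpha>) (f \<alpha> *\<^sub>C x))"
    using T by (auto simp: blinfun.sum_left scale_op.rep_eq word_op_scaleC words_def intro!: sum.cong)
  also have "norm \<dots> \<le> tuple_norm n T ^ d * L2_set (\<lambda>\<alpha>. norm (f \<alpha> *\<^sub>C x)) (words n d)"
    by (rule norm_sum_word_op_le [OF T])
  also have "\<dots> = tuple_norm n T ^ d * (coeff_norm n f d * norm x)"
    by (simp add: norm_scaleC coeff_norm_def L2_set_left_distrib)
  also have "\<dots> \<le> \<rho> ^ d * (coeff_norm n f d * norm x)"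
    using assms(2) tuple_norm_nonneg [of n T] by (intro mult_right_mono power_mono) simp_all
  finally show "norm (blinfun_apply (\<Sum>\<alpha>\<in>words n d. scale_op (f \<alpha>) (word_op T \<alpha>)) x)
    \<le> coeff_norm n f d * \<rho> ^ d * norm x" by (simp add: mult_ac)
qed

text \<open>Domination degree by degree. Convergence is recorded along with the bound because the
  \<open>suminf\<close> in \<open>series_eval\<close> is informative only for a convergent
  series.\<close>

lemma summable_series_eval:
  fixes T :: "nat \<Rightarrow> ('h::complex_hilbert_space \<Rightarrow>\<^sub>L 'h)"
  assumes "\<forall>i\<in>{1..n}. T i \<in> bounded_ops" and "tuple_norm n T \<le> \<rho>"
    and "summable (\<lambda>d. coeff_norm n f d * \<rho> ^ d)"
  shows "summable (\<lambda>d. \<Sum>\<alpha>\<in>words n d. scale_op (f \<alpha>) (word_op T \<alpha>))"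
    and "norm (series_eval n f T) \<le> (\<Sum>d. coeff_norm n f d * \<rho> ^ d)"
proof -
  let ?h = "\<lambda>d. \<Sum>\<alpha>\<in>words n d. scale_op (f \<alpha>) (word_op T \<alpha>)"
  have s: "summable (\<lambda>d. norm (?h d))"
    by (rule summable_comparison_test [OF _ assms(3)])
      (use norm_homogeneous_eval_le [OF assms(1,2)] in auto)
  show "summable ?h" by (rule summable_norm_cancel [OF s])
  have "norm (series_eval n f T) \<le> (\<Sum>d. norm (?h d))"
    unfolding series_eval_def by (rule summable_norm [OF s])
  also have "\<dots> \<le> (\<Sum>d. coeff_norm n f d * \<rho> ^ d)"
    by (rule suminf_le [OF _ s assms(3)]) (rule norm_homogeneous_eval_le [OF assms(1,2)])
  finally show "norm (series_eval n f T) \<le> (\<Sum>d. coeff_norm n f d * \<rho> ^ d)" .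
qed


section \<open>Orthonormal families and truncated shifts\<close>

definition orthonormal_on :: "'i set \<Rightarrow> ('i \<Rightarrow> 'h::complex_inner) \<Rightarrow> bool" where
  "orthonormal_on I e \<longleftrightarrow> (\<forall>i\<in>I. \<forall>j\<in>I. cinner (e i) (e j) = (if i = j then 1 else 0))"

lemma norm_orthonormal:
  assumes "orthonormal_on I e" and "i \<in> I"
  shows "norm (e i) = 1"
proof -
  have "(norm (e i))\<^sup>2 = 1" using assms by (simp add: power2_norm_eq_cinner orthonormal_on_def)
  then show ?thesis using norm_ge_zero [of "e i"] by (simp add: power2_eq_1_iff)
qed

lemma cinner_orthonormal_sum:
  assumes "orthonormal_on I e" and "finite J" and "J \<subseteq> I" and "i \<in> I"
  shows "cinner (e i) (\<Sum>j\<in>J. c j *\<^sub>C e j) = (if i \<in> J then cnj (c i) else 0)"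
proof -
  have "cinner (e i) (\<Sum>j\<in>J. c j *\<^sub>C e j) = (\<Sum>j\<in>J. if i = j then cnj (c j) else 0)"
    unfolding cinner_sum_right cinner_scaleC_right
    by (rule sum.cong) (use assms in \<open>auto simp: orthonormal_on_def\<close>)
  then show ?thesis using assms(2) by simp
qed

lemma norm_orthonormal_sum:
  assumes "orthonormal_on I e" and "finite J" and "J \<subseteq> I"
  shows "norm (\<Sum>j\<in>J. c j *\<^sub>C e j) = L2_set (\<lambda>j. cmod (c j)) J"
proof -
  have "cinner (\<Sum>j\<in>J. c j *\<^sub>C e j) (\<Sum>j\<in>J. c j *\<^sub>C e j) = (\<Sum>i\<in>J. c i * cnj (c i))"
    using assms(3) by (auto simp: cinner_sum_left cinner_scaleC_left cinner_orthonormal_sum [OF assms] intro!: sum.cong)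
  also have "\<dots> = complex_of_real (\<Sum>i\<in>J. (cmod (c i))\<^sup>2)"
    by (simp add: complex_norm_square del: of_real_power)
  finally have "(norm (\<Sum>j\<in>J. c j *\<^sub>C e j))\<^sup>2 = (\<Sum>i\<in>J. (cmod (c i))\<^sup>2)"
    by (simp add: power2_norm_eq_cinner)
  then show ?thesis by (simp add: L2_set_def real_sqrt_unique)
qed

text \<open>With \<open>y\<close> the projection of \<open>x\<close> onto the span of the family,
  both \<open>cinner x y\<close> and the square of \<open>norm y\<close> equal the square of
  \<open>L\<close>; Cauchy-Schwarz then gives the bound after cancelling \<open>L\<close>.\<close>

lemma Bessel_inequality:
  assumes "orthonormal_on I e" and "finite J" and "J \<subseteq> I"
  shows "L2_set (\<lambda>j. cmod (cinner x (e j))) J \<le> norm x"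
proof -
  define y where "y = (\<Sum>j\<in>J. cinner x (e j) *\<^sub>C e j)"
  define L where "L = L2_set (\<lambda>j. cmod (cinner x (e j))) J"
  have "cinner x y = complex_of_real (\<Sum>j\<in>J. (cmod (cinner x (e j)))\<^sup>2)"
    by (simp add: y_def cinner_sum_right cinner_scaleC_right complex_norm_square mult.commute del: of_real_power)
  then have "cinner x y = complex_of_real (L\<^sup>2)"
    by (simp add: L_def L2_set_def sum_nonneg del: of_real_power)
  moreover have "norm y = L" unfolding y_def L_def by (rule norm_orthonormal_sum [OF assms])
  ultimately have "L\<^sup>2 \<le> norm x * L" using cinner_Cauchy_Schwarz [of x y] by (simp add: norm_power)
  moreover have "0 \<le> L" by (simp add: L_def)
  ultimately show ?thesis
    unfolding L_def [symmetric] by (cases "L = 0") (simp_all add: power2_eq_square)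
qed

text \<open>One Gram-Schmidt step per index: finitely many vectors do not span the space, so a
  vector outside their span has a nonzero component orthogonal to them, which is normalized. The
  index type is arbitrary so that words can serve as indices.\<close>

lemma orthonormal_on_exists:
  assumes "infinite_dimensional TYPE('h::complex_inner)" and "finite I"
  shows "\<exists>e :: 'i \<Rightarrow> 'h. orthonormal_on I e"
  using assms(2)
proof induction
  case empty
  then show ?case by (simp add: orthonormal_on_def)
next
  case (insert a I)
  then obtain e :: "'i \<Rightarrow> 'h" where e: "orthonormal_on I e" by blast
  obtain x where x: "x \<notin> complex_vector.span (e ` I)"
    using assms(1) insert.hyps(1) unfolding infinite_dimensional_def by (metis UNIV_eq_I finite_imageI)
  define y where "y = x - (\<Sum>i\<in>I. cinner x (e i) *\<^sub>C e i)"
  have "(\<Sum>i\<in>I. cinner x (e i) *\<^sub>C e i) \<in> complex_vector.span (e ` I)"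
    by (intro complex_vector.span_sum complex_vector.span_scale complex_vector.span_base imageI)
  with x have "y \<noteq> 0" by (auto simp: y_def)
  define u where "u = complex_of_real (1 / norm y) *\<^sub>C y"
  have ey: "cinner (e i) y = 0" if "i \<in> I" for i
    using cinner_orthonormal_sum [OF e insert.hyps(1) order_refl that, of "\<lambda>i. cinner x (e i)"] that
    by (simp add: y_def cinner_diff_right cinner_commute [of "e i" x])
  have eu: "cinner (e i) u = 0" "cinner u (e i) = 0" if "i \<in> I" for i
    using ey [OF that] cinner_commute [of y "e i"] by (simp_all add: u_def cinner_scaleC_right cinner_scaleC_left)
  have "cinner u u = 1"
    using \<open>y \<noteq> 0\<close> by (simp add: cinner_norm u_def norm_scaleC norm_divide)
  then have "orthonormal_on (insert a I) (e(a := u))"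
    using e eu insert.hyps(2) by (auto simp: orthonormal_on_def)
  then show ?case by blast
qed

section \<open>Creation operators on a truncated Fock space\<close>

lemma bounded_linear_rank_one: "bounded_linear (\<lambda>x. cinner x u *\<^sub>C (v::'h::complex_inner))"
proof (rule bounded_linear_intro [where K = "norm u * norm v"])
  show "cinner (x + y) u *\<^sub>C v = cinner x u *\<^sub>C v + cinner y u *\<^sub>C v" for x y
    by (simp add: cinner_add_left scaleC_add_left)
  show "cinner (t *\<^sub>R x) u *\<^sub>C v = t *\<^sub>R (cinner x u *\<^sub>C v)" for t x
    by (simp add: cinner_scaleC_left scaleC_scaleC flip: scaleC_of_real)
  show "norm (cinner x u *\<^sub>C v) \<le> norm x * (norm u * norm v)" for x
    using mult_right_mono [OF cinner_Cauchy_Schwarz [of x u], of "norm v"] by (simp add: norm_scaleC mult.assoc)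
qed

lemma bounded_linear_cinner_left: "bounded_linear (\<lambda>x. cinner x (u::'h::complex_inner))"
  by (rule bounded_linear_intro [where K = "norm u"])
    (simp_all add: cinner_add_left cinner_scaleR_left cinner_Cauchy_Schwarz)

text \<open>Left creation operators on the full Fock space, scaled by \<open>\<rho>\<close> and compressed to tensors
  of degree at most \<open>N\<close>; \<open>e\<close> embeds this finite-dimensional space into the Hilbert space.\<close>

definition truncated_shift ::
    "(nat list \<Rightarrow> 'h::complex_hilbert_space) \<Rightarrow> nat \<Rightarrow> nat \<Rightarrow> real \<Rightarrow> nat \<Rightarrow> 'h \<Rightarrow>\<^sub>L 'h" where
  "truncated_shift e n N \<rho> i =
     Blinfun (\<lambda>x. \<Sum>\<alpha>\<in>(\<Union>d<N. words n d). cinner x (e \<alpha>) *\<^sub>C (complex_of_real \<rho> *\<^sub>C e (i # \<alpha>)))"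

lemma truncated_shift_apply:
  "blinfun_apply (truncated_shift e n N \<rho> i) x =
     (\<Sum>\<alpha>\<in>(\<Union>d<N. words n d). (complex_of_real \<rho> * cinner x (e \<alpha>)) *\<^sub>C e (i # \<alpha>))"
proof -
  have "bounded_linear (\<lambda>x. \<Sum>\<alpha>\<in>(\<Union>d<N. words n d). cinner x (e \<alpha>) *\<^sub>C (complex_of_real \<rho> *\<^sub>C e (i # \<alpha>)))"
    by (intro bounded_linear_sum bounded_linear_rank_one)
  then show ?thesis
    by (simp add: truncated_shift_def bounded_linear_Blinfun_apply scaleC_scaleC mult.commute)
qed

lemma truncated_shift_in_bounded_ops: "truncated_shift e n N \<rho> i \<in> bounded_ops"
  by (simp add: bounded_ops_def truncated_shift_apply cinner_scaleC_left complex_vector.scale_sum_right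
      scaleC_scaleC mult_ac)

text \<open>Prepending a letter is injective on pairs of letter and word, so the row sends
  orthonormal vectors to \<open>\<rho>\<close> times orthonormal vectors. Pythagoras computes the
  norm of an image, and Bessel compares it with the norm of the input.\<close>

lemma tuple_norm_truncated_shift_le:
  assumes e: "orthonormal_on (\<Union>d\<le>N. words n d) e" and "0 \<le> \<rho>"
  shows "tuple_norm n (truncated_shift e n N \<rho>) \<le> \<rho>"
proof (rule tuple_norm_leI)
  let ?V = "\<Union>d<N. words n d"
  have V: "?V \<subseteq> (\<Union>d\<le>N. words n d)" by force
  have "orthonormal_on ({1..n} \<times> ?V) (\<lambda>(i, \<alpha>). e (i # \<alpha>))"
  proof -
    \<comment> \<open>The words in the sum have length below \<open>N\<close>, so a prepended letter
      leads to length at most \<open>N\<close>, where \<open>e\<close> is still orthonormal.\<close>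
    have "i # \<alpha> \<in> (\<Union>d\<le>N. words n d)" if "i \<in> {1..n}" "\<alpha> \<in> ?V" for i \<alpha>
      using that by (auto simp: words_def)
    then have *: "cinner (e (i # \<alpha>)) (e (j # \<beta>)) = (if i = j \<and> \<alpha> = \<beta> then 1 else 0)"
      if "i \<in> {1..n}" "\<alpha> \<in> ?V" "j \<in> {1..n}" "\<beta> \<in> ?V" for i j \<alpha> \<beta>
      using e that unfolding orthonormal_on_def by (metis list.inject)
    show ?thesis unfolding orthonormal_on_def
    proof (intro ballI)
      fix p q assume "p \<in> {1..n} \<times> ?V" "q \<in> {1..n} \<times> ?V"
      then show "cinner (case p of (i, \<alpha>) \<Rightarrow> e (i # \<alpha>)) (case q of (i, \<alpha>) \<Rightarrow> e (i # \<alpha>)) = (if p = q then 1 else 0)"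
        using * [of "fst p" "snd p" "fst q" "snd q"]
        by (simp add: case_prod_beta prod_eq_iff mem_Times_iff del: UN_iff)
    qed
  qed
  note norm_eq = norm_orthonormal_sum [OF this _ order_refl]
  fix x
  have "(\<Sum>i=1..n. blinfun_apply (truncated_shift e n N \<rho> i) (x i))
    = (\<Sum>(i, \<alpha>)\<in>{1..n} \<times> ?V. (complex_of_real \<rho> * cinner (x i) (e \<alpha>)) *\<^sub>C e (i # \<alpha>))"
    by (simp add: truncated_shift_apply sum.cartesian_product)
  also have "norm \<dots> = L2_set (\<lambda>(i, \<alpha>). \<rho> * cmod (cinner (x i) (e \<alpha>))) ({1..n} \<times> ?V)"
    using norm_eq [of "\<lambda>(i, \<alpha>). complex_of_real \<rho> * cinner (x i) (e \<alpha>)"] \<open>0 \<le> \<rho>\<close>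
    by (simp add: case_prod_unfold norm_mult)
  also have "\<dots> = L2_set (\<lambda>i. \<rho> * L2_set (\<lambda>\<alpha>. cmod (cinner (x i) (e \<alpha>))) ?V) {1..n}"
    by (simp add: L2_set_def sum.cartesian_product case_prod_unfold power_mult_distrib
        sum_distrib_left sum_nonneg)
  also have "\<dots> \<le> L2_set (\<lambda>i. \<rho> * norm (x i)) {1..n}"
    using \<open>0 \<le> \<rho>\<close> by (intro L2_set_mono mult_left_mono Bessel_inequality [OF e _ V]) simp_all
  also have "\<dots> = \<rho> * L2_set (\<lambda>i. norm (x i)) {1..n}"
    by (rule L2_set_right_distrib [OF \<open>0 \<le> \<rho>\<close>, symmetric])
  finally show "norm (\<Sum>i=1..n. blinfun_apply (truncated_shift e n N \<rho> i) (x i))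
    \<le> \<rho> * L2_set (\<lambda>i. norm (x i)) {1..n}" .
qed (simp_all add: truncated_shift_in_bounded_ops \<open>0 \<le> \<rho>\<close>)

lemma truncated_shift_basis:
  assumes e: "orthonormal_on (\<Union>d\<le>N. words n d) e" and \<alpha>: "\<alpha> \<in> (\<Union>d\<le>N. words n d)"
  shows "blinfun_apply (truncated_shift e n N \<rho> i) (e \<alpha>)
    = (if length \<alpha> < N then complex_of_real \<rho> *\<^sub>C e (i # \<alpha>) else 0)"
proof -
  have "cinner (e \<alpha>) (e \<beta>) = (if \<alpha> = \<beta> then 1 else 0)" if "\<beta> \<in> (\<Union>d<N. words n d)" for \<beta>
    using e \<alpha> that unfolding orthonormal_on_def by (metis (no_types, lifting) UN_iff atMost_iff lessThan_iff less_imp_le)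
  then have "blinfun_apply (truncated_shift e n N \<rho> i) (e \<alpha>)
    = (\<Sum>\<beta>\<in>(\<Union>d<N. words n d). if \<alpha> = \<beta> then complex_of_real \<rho> *\<^sub>C e (i # \<beta>) else 0)"
    unfolding truncated_shift_apply by (intro sum.cong) auto
  also have "\<dots> = (if \<alpha> \<in> (\<Union>d<N. words n d) then complex_of_real \<rho> *\<^sub>C e (i # \<alpha>) else 0)"
    by (subst sum.delta') simp_all
  also have "\<alpha> \<in> (\<Union>d<N. words n d) \<longleftrightarrow> length \<alpha> < N"
    using \<alpha> by (auto simp: words_def)
  finally show ?thesis .
qed

text \<open>\<open>e []\<close> plays the vacuum vector. The leftmost operator acts last, so the
  letters are prepended in the order that spells \<open>\<alpha>\<close>; a vector pushed beyond
  degree \<open>N\<close> becomes zero and stays zero.\<close>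

lemma word_op_truncated_shift:
  assumes e: "orthonormal_on (\<Union>d\<le>N. words n d) e" and "set \<alpha> \<subseteq> {1..n}"
  shows "blinfun_apply (word_op (truncated_shift e n N \<rho>) \<alpha>) (e [])
    = (if length \<alpha> \<le> N then complex_of_real (\<rho> ^ length \<alpha>) *\<^sub>C e \<alpha> else 0)"
  using assms(2)
proof (induction \<alpha>)
  case Nil
  then show ?case using scaleC_of_real [of 1 "e []"] by simp
next
  case (Cons i \<alpha>)
  have hom: "blinfun_apply (truncated_shift e n N \<rho> i) (c *\<^sub>C x)
    = c *\<^sub>C blinfun_apply (truncated_shift e n N \<rho> i) x" for c x
    using truncated_shift_in_bounded_ops [of e n N \<rho> i] by (simp add: bounded_ops_def)
  show ?case
  proof (cases "length \<alpha> \<le> N")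
    case True
    then have "\<alpha> \<in> (\<Union>d\<le>N. words n d)" using Cons.prems by (auto simp: words_def)
    then show ?thesis using Cons True
      by (simp add: hom truncated_shift_basis [OF e] scaleC_scaleC Suc_le_eq mult.commute)
  qed (use Cons in simp)
qed

text \<open>The image of the vacuum under \<open>f(T)\<close>, for a shift tuple \<open>T\<close>
  chosen for this \<open>N\<close>, is paired with the direction \<open>v\<close> of its degree
  \<open>N\<close> component. This pairing is the square of \<open>L\<close> times
  \<open>\<rho> ^ N\<close>, while Cauchy-Schwarz bounds it by \<open>L\<close> times the norm of
  \<open>f(T)\<close>.\<close>

lemma coeff_norm_le_popescu_seminorm:
  assumes inf: "infinite_dimensional TYPE('h::complex_hilbert_space)" and "0 \<le> \<rho>"
    and sf: "summable (\<lambda>d. coeff_norm n f d * \<rho> ^ d)"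
  shows "ennreal (coeff_norm n f N * \<rho> ^ N) \<le> popescu_seminorm TYPE('h) n \<rho> f"
proof -
  obtain e :: "nat list \<Rightarrow> 'h" where e: "orthonormal_on (\<Union>d\<le>N. words n d) e"
    using orthonormal_on_exists [OF inf, of "\<Union>d\<le>N. words n d"] by auto
  define T where "T = truncated_shift e n N \<rho>"
  have T: "\<forall>i\<in>{1..n}. T i \<in> bounded_ops" and T_le: "tuple_norm n T \<le> \<rho>"
    using tuple_norm_truncated_shift_le [OF e \<open>0 \<le> \<rho>\<close>] by (simp_all add: T_def truncated_shift_in_bounded_ops)
  define L where "L = coeff_norm n f N"
  define v where "v = (\<Sum>\<alpha>\<in>words n N. f \<alpha> *\<^sub>C e \<alpha>)"
  have v: "norm v = L"
    unfolding v_def L_def coeff_norm_def by (rule norm_orthonormal_sum [OF e]) auto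
  let ?h = "\<lambda>d. \<Sum>\<alpha>\<in>words n d. scale_op (f \<alpha>) (word_op T \<alpha>)"
  have ev: "cinner (e \<alpha>) v = (if \<alpha> \<in> words n N then cnj (f \<alpha>) else 0)"
    if "\<alpha> \<in> (\<Union>d\<le>N. words n d)" for \<alpha>
    unfolding v_def by (rule cinner_orthonormal_sum [OF e _ _ that]) auto
  \<comment> \<open>Only degree \<open>N\<close> survives: lower degrees are orthogonal to
    \<open>v\<close>, higher ones are annihilated by the truncation.\<close>
  have hv: "cinner (blinfun_apply (?h d) (e [])) v = (if d = N then complex_of_real (L\<^sup>2 * \<rho> ^ N) else 0)" for d
  proof -
    have "cinner (blinfun_apply (?h d) (e [])) v
      = (\<Sum>\<alpha>\<in>words n d. f \<alpha> * cinner (blinfun_apply (word_op T \<alpha>) (e [])) v)"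
      by (simp add: blinfun.sum_left scale_op.rep_eq cinner_sum_left cinner_scaleC_left)
    also have "\<dots> = (\<Sum>\<alpha>\<in>words n d. if d = N then complex_of_real ((cmod (f \<alpha>))\<^sup>2 * \<rho> ^ N) else 0)"
    proof (rule sum.cong [OF refl])
      fix \<alpha> assume \<alpha>: "\<alpha> \<in> words n d"
      then have \<alpha>': "length \<alpha> = d" "set \<alpha> \<subseteq> {1..n}" by (auto simp: words_def)
      show "f \<alpha> * cinner (blinfun_apply (word_op T \<alpha>) (e [])) v
        = (if d = N then complex_of_real ((cmod (f \<alpha>))\<^sup>2 * \<rho> ^ N) else 0)"
      proof (cases "d \<le> N")
        case True
        with \<alpha> have "\<alpha> \<in> (\<Union>d\<le>N. words n d)" by blast
        moreover have "\<alpha> \<in> words n N \<longleftrightarrow> d = N" using \<alpha>' by (auto simp: words_def)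
        ultimately show ?thesis
          using True \<alpha>' complex_norm_square [of "f \<alpha>"]
          by (simp add: T_def word_op_truncated_shift [OF e] cinner_scaleC_left ev)
      qed (use \<alpha>' in \<open>simp add: T_def word_op_truncated_shift [OF e]\<close>)
    qed
    also have "\<dots> = (if d = N then complex_of_real (L\<^sup>2 * \<rho> ^ N) else 0)"
      by (simp add: L_def coeff_norm_def L2_set_def sum_nonneg sum_distrib_right)
    finally show ?thesis .
  qed
  have "?h sums series_eval n f T"
    unfolding series_eval_def by (rule summable_sums [OF summable_series_eval(1) [OF T T_le sf]])
  \<comment> \<open>Evaluation at \<open>e []\<close> and pairing with \<open>v\<close> are bounded
    linear, so they pass through the infinite sum.\<close>
  then have "(\<lambda>d. cinner (blinfun_apply (?h d) (e [])) v) sums cinner (blinfun_apply (series_eval n f T) (e [])) v"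
    by (intro bounded_linear.sums [OF bounded_linear_cinner_left] bounded_linear.sums [OF blinfun.bounded_linear_left])
  moreover have "(\<lambda>d. cinner (blinfun_apply (?h d) (e [])) v) sums complex_of_real (L\<^sup>2 * \<rho> ^ N)"
    unfolding hv using sums_single [of N "\<lambda>_. complex_of_real (L\<^sup>2 * \<rho> ^ N)"] by simp
  ultimately have "cinner (blinfun_apply (series_eval n f T) (e [])) v = complex_of_real (L\<^sup>2 * \<rho> ^ N)"
    by (rule sums_unique2)
  then have "L\<^sup>2 * \<rho> ^ N = cmod (cinner (blinfun_apply (series_eval n f T) (e [])) v)"
    using \<open>0 \<le> \<rho>\<close> by (simp add: norm_mult norm_power)
  also have "\<dots> \<le> norm (blinfun_apply (series_eval n f T) (e [])) * L"
    using cinner_Cauchy_Schwarz [of _ v] by (simp add: v)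
  also have "\<dots> \<le> norm (series_eval n f T) * L"
  proof (intro mult_right_mono)
    have "norm (e []) = 1" by (rule norm_orthonormal [OF e]) (use words_0 in blast)
    then show "norm (blinfun_apply (series_eval n f T) (e [])) \<le> norm (series_eval n f T)"
      using norm_blinfun [of "series_eval n f T" "e []"] by simp
  qed (simp add: L_def)
  finally have "L * \<rho> ^ N \<le> norm (series_eval n f T)"
    by (cases "L = 0") (auto simp: L_def power2_eq_square less_le)
  then have "ennreal (coeff_norm n f N * \<rho> ^ N) \<le> ennreal (norm (series_eval n f T))"
    by (simp add: L_def ennreal_leI)
  also have "\<dots> \<le> popescu_seminorm TYPE('h) n \<rho> f"
    unfolding popescu_seminorm_def using T T_le by (intro SUP_upper) simp
  finally show ?thesis .
qed


section \<open>The two algebras\<close>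

lemma free_ball_norm_eq:
  assumes "0 \<le> \<rho>" and "summable (\<lambda>d. coeff_norm n f d * \<rho> ^ d)"
  shows "free_ball_norm n \<rho> f = ennreal (\<Sum>d. coeff_norm n f d * \<rho> ^ d)"
  unfolding free_ball_norm_def L2_set_def [symmetric] coeff_norm_def [symmetric]
  using assms by (intro suminf_ennreal2) simp_all

lemma free_ball_norm_finite_iff:
  assumes "0 \<le> \<rho>"
  shows "free_ball_norm n \<rho> f < \<infinity> \<longleftrightarrow> summable (\<lambda>d. coeff_norm n f d * \<rho> ^ d)"
proof
  assume "free_ball_norm n \<rho> f < \<infinity>"
  then show "summable (\<lambda>d. coeff_norm n f d * \<rho> ^ d)"
    unfolding free_ball_norm_def L2_set_def [symmetric] coeff_norm_def [symmetric]
    using assms by (intro summable_suminf_not_top) auto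
qed (use assms in \<open>simp add: free_ball_norm_eq\<close>)

lemma free_ball_algebra_iff:
  "f \<in> free_ball_algebra n r \<longleftrightarrow>
     f \<in> formal_series n \<and> (\<forall>\<rho>. 0 < \<rho> \<and> ereal \<rho> < r \<longrightarrow> summable (\<lambda>d. coeff_norm n f d * \<rho> ^ d))"
  unfolding free_ball_algebra_def using free_ball_norm_finite_iff [of _ n f] by auto

text \<open>Taking the power \<open>1 / (2 * d)\<close> of the sum of squares is the
  \<open>d\<close>-th root of the \<ell>2-norm, so Popescu's radius is the Cauchy-Hadamard radius of
  the sequence \<open>coeff_norm n f\<close>.\<close>

lemma radius_of_convergence_eq: "radius_of_convergence n f = conv_radius (coeff_norm n f)"
proof -
  have "(\<Sum>\<alpha>\<in>words n d. (cmod (f \<alpha>))\<^sup>2) powr (1 / (2 * real d)) = root d (norm (coeff_norm n f d))"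
    if "0 < d" for d
  proof -
    have "0 \<le> (\<Sum>\<alpha>\<in>words n d. (cmod (f \<alpha>))\<^sup>2)" by (simp add: sum_nonneg)
    moreover have "S powr (1 / (2 * real d)) = root d (sqrt S)" if "0 \<le> S" for S :: real
    proof (cases "S = 0")
      case False
      with that \<open>0 < d\<close> show ?thesis
        by (simp add: root_powr_inverse powr_half_sqrt [symmetric] powr_powr)
    qed simp
    ultimately show ?thesis by (simp add: coeff_norm_def L2_set_def sum_nonneg)
  qed
  \<comment> \<open>At \<open>d = 0\<close> the two expressions may differ through the conventions
    for division by zero and \<open>root 0\<close>; the limsup sees only large
    \<open>d\<close>.\<close>
  then have "\<forall>\<^sub>F d in sequentially.
      ereal ((\<Sum>\<alpha>\<in>words n d. (cmod (f \<alpha>))\<^sup>2) powr (1 / (2 * real d))) = ereal (root d (norm (coeff_norm n f d)))"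
    by (intro eventually_mono [OF eventually_gt_at_top [of 0]]) simp
  from Limsup_eq [OF this] show ?thesis
    by (simp only: radius_of_convergence_def conv_radius_def)
qed

text \<open>A power series converges inside its disc of convergence, and convergence at every
  positive \<open>\<rho>\<close> below \<open>r\<close> forces the radius to be at least
  \<open>r\<close>.\<close>

lemma popescu_algebra_eq: "popescu_algebra n r = free_ball_algebra n r"
proof -
  have "r \<le> conv_radius (coeff_norm n f) \<longleftrightarrow>
    (\<forall>\<rho>. 0 < \<rho> \<and> ereal \<rho> < r \<longrightarrow> summable (\<lambda>d. coeff_norm n f d * \<rho> ^ d))" for f
  proof (intro iffI allI impI)
    fix \<rho> assume "r \<le> conv_radius (coeff_norm n f)" and "0 < \<rho> \<and> ereal \<rho> < r"
    then show "summable (\<lambda>d. coeff_norm n f d * \<rho> ^ d)"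
      by (intro summable_in_conv_radius) auto
  next
    assume *: "\<forall>\<rho>. 0 < \<rho> \<and> ereal \<rho> < r \<longrightarrow> summable (\<lambda>d. coeff_norm n f d * \<rho> ^ d)"
    show "r \<le> conv_radius (coeff_norm n f)"
      by (rule conv_radius_geI_ex') (use * in simp)
  qed
  then show ?thesis
    by (auto simp: popescu_algebra_def free_ball_algebra_iff radius_of_convergence_eq)
qed

section \<open>Closure under the algebra operations\<close>

lemma coeff_norm_add: "coeff_norm n (series_add f g) d \<le> coeff_norm n f d + coeff_norm n g d"
proof -
  have "coeff_norm n (series_add f g) d \<le> L2_set (\<lambda>\<alpha>. cmod (f \<alpha>) + cmod (g \<alpha>)) (words n d)"
    unfolding coeff_norm_def series_add_def by (intro L2_set_mono norm_triangle_ineq) simp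
  also have "\<dots> \<le> coeff_norm n f d + coeff_norm n g d"
    unfolding coeff_norm_def by (rule L2_set_triangle_ineq)
  finally show ?thesis .
qed

lemma coeff_norm_scale: "coeff_norm n (series_scale c f) d = cmod c * coeff_norm n f d"
  by (simp add: coeff_norm_def series_scale_def norm_mult L2_set_right_distrib)

lemma L2_set_sum_le: "L2_set (\<lambda>i. \<Sum>k\<in>K. h k i) A \<le> (\<Sum>k\<in>K. L2_set (h k) A)"
proof (induction K rule: infinite_finite_induct)
  case (insert k K)
  then show ?case using L2_set_triangle_ineq [of "h k" "\<lambda>i. \<Sum>k\<in>K. h k i" A] by simp
qed (simp_all add: L2_set_def)

text \<open>A factorization of \<open>\<alpha>\<close> is determined by the length of its left
  factor, so the sum runs over cut positions.\<close>

lemma series_mult_eq: "series_mult f g \<alpha> = (\<Sum>k\<le>length \<alpha>. f (take k \<alpha>) * g (drop k \<alpha>))"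
  unfolding series_mult_def
  by (rule sum.reindex_bij_witness [of _ "\<lambda>k. (take k \<alpha>, drop k \<alpha>)" "\<lambda>(\<beta>, \<gamma>). length \<beta>"]) auto

text \<open>Cutting at position \<open>k\<close> identifies words of length \<open>d\<close> with
  pairs of words of lengths \<open>k\<close> and \<open>d - k\<close>, so the \<ell>2-norm of the
  \<open>k\<close>-th summand factors. Minkowski's inequality adds up the cut positions.\<close>

lemma coeff_norm_mult:
  "coeff_norm n (series_mult f g) d \<le> (\<Sum>k\<le>d. coeff_norm n f k * coeff_norm n g (d - k))"
proof -
  have split: "L2_set (\<lambda>\<alpha>. cmod (f (take k \<alpha>)) * cmod (g (drop k \<alpha>))) (words n d)
    = coeff_norm n f k * coeff_norm n g (d - k)" if "k \<le> d" for k
  proof -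
    have "(\<Sum>\<alpha>\<in>words n d. (cmod (f (take k \<alpha>)))\<^sup>2 * (cmod (g (drop k \<alpha>)))\<^sup>2)
      = (\<Sum>(\<beta>, \<gamma>)\<in>words n k \<times> words n (d - k). (cmod (f \<beta>))\<^sup>2 * (cmod (g \<gamma>))\<^sup>2)"
      by (rule sum.reindex_bij_witness [of _ "\<lambda>(\<beta>, \<gamma>). \<beta> @ \<gamma>" "\<lambda>\<alpha>. (take k \<alpha>, drop k \<alpha>)"])
        (use that in \<open>auto simp: words_def dest: in_set_takeD in_set_dropD\<close>)
    then show ?thesis
      by (simp add: coeff_norm_def L2_set_def power_mult_distrib sum_product sum.cartesian_product
          flip: real_sqrt_mult)
  qed
  have "coeff_norm n (series_mult f g) d
    \<le> L2_set (\<lambda>\<alpha>. \<Sum>k\<le>d. cmod (f (take k \<alpha>)) * cmod (g (drop k \<alpha>))) (words n d)"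
    unfolding coeff_norm_def
  proof (intro L2_set_mono norm_ge_zero)
    fix \<alpha> assume "\<alpha> \<in> words n d"
    then have "length \<alpha> = d" by (simp add: words_def)
    then show "cmod (series_mult f g \<alpha>) \<le> (\<Sum>k\<le>d. cmod (f (take k \<alpha>)) * cmod (g (drop k \<alpha>)))"
      unfolding series_mult_eq using norm_sum [of "\<lambda>k. f (take k \<alpha>) * g (drop k \<alpha>)" "{..d}"]
      by (simp add: norm_mult)
  qed
  also have "\<dots> \<le> (\<Sum>k\<le>d. L2_set (\<lambda>\<alpha>. cmod (f (take k \<alpha>)) * cmod (g (drop k \<alpha>))) (words n d))"
    by (rule L2_set_sum_le)
  also have "\<dots> = (\<Sum>k\<le>d. coeff_norm n f k * coeff_norm n g (d - k))"
    by (simp add: split)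
  finally show ?thesis .
qed

lemma formal_series_iff: "f \<in> formal_series n \<longleftrightarrow> (\<forall>\<alpha>. \<not> set \<alpha> \<subseteq> {1..n} \<longrightarrow> f \<alpha> = 0)"
  by (auto simp: formal_series_def words_def)

lemma summable_coeff_norm_le:
  assumes "0 \<le> \<rho>" and "summable h" and "\<And>d. coeff_norm n f d * \<rho> ^ d \<le> h d"
  shows "summable (\<lambda>d. coeff_norm n f d * \<rho> ^ d)"
  by (rule summable_comparison_test [OF _ assms(2)]) (use assms in auto)

lemma free_ball_algebra_add:
  assumes "f \<in> free_ball_algebra n r" and "g \<in> free_ball_algebra n r"
  shows "series_add f g \<in> free_ball_algebra n r"
  unfolding free_ball_algebra_iff
proof (intro conjI allI impI)
  show "series_add f g \<in> formal_series n"
    using assms by (auto simp: free_ball_algebra_iff formal_series_iff series_add_def)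
  fix \<rho> assume \<rho>: "0 < \<rho> \<and> ereal \<rho> < r"
  then have "summable (\<lambda>d. coeff_norm n f d * \<rho> ^ d + coeff_norm n g d * \<rho> ^ d)"
    using assms by (intro summable_add) (simp_all add: free_ball_algebra_iff)
  then show "summable (\<lambda>d. coeff_norm n (series_add f g) d * \<rho> ^ d)"
    by (rule summable_coeff_norm_le [rotated])
      (use \<rho> coeff_norm_add [of n f g] in \<open>simp_all add: mult_right_mono flip: distrib_right\<close>)
qed

lemma free_ball_algebra_scale:
  assumes "f \<in> free_ball_algebra n r"
  shows "series_scale c f \<in> free_ball_algebra n r"
  unfolding free_ball_algebra_iff coeff_norm_scale mult.assoc
proof (intro conjI allI impI summable_mult)
  show "series_scale c f \<in> formal_series n"
    using assms by (simp add: free_ball_algebra_iff formal_series_iff series_scale_def)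
qed (use assms in \<open>simp add: free_ball_algebra_iff\<close>)

lemma series_diff_eq: "series_diff f g = series_add f (series_scale (- 1) g)"
  by (simp add: fun_eq_iff series_diff_def series_add_def series_scale_def)

lemma free_ball_algebra_diff:
  assumes "f \<in> free_ball_algebra n r" and "g \<in> free_ball_algebra n r"
  shows "series_diff f g \<in> free_ball_algebra n r"
  using assms by (simp add: series_diff_eq free_ball_algebra_add free_ball_algebra_scale)

lemma free_ball_algebra_mult:
  assumes "f \<in> free_ball_algebra n r" and "g \<in> free_ball_algebra n r"
  shows "series_mult f g \<in> free_ball_algebra n r"
  unfolding free_ball_algebra_iff
proof (intro conjI allI impI)
  have "f (take k \<alpha>) * g (drop k \<alpha>) = 0" if "\<not> set \<alpha> \<subseteq> {1..n}" for k \<alpha>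
  proof -
    have "\<not> set (take k \<alpha>) \<subseteq> {1..n} \<or> \<not> set (drop k \<alpha>) \<subseteq> {1..n}"
      using that by (metis append_take_drop_id set_append Un_subset_iff)
    then show ?thesis using assms by (auto simp: free_ball_algebra_iff formal_series_iff)
  qed
  then show "series_mult f g \<in> formal_series n"
    unfolding formal_series_iff series_mult_eq by (intro allI impI sum.neutral ballI)
  fix \<rho> assume \<rho>: "0 < \<rho> \<and> ereal \<rho> < r"
  let ?a = "\<lambda>d. coeff_norm n f d * \<rho> ^ d" and ?b = "\<lambda>d. coeff_norm n g d * \<rho> ^ d"
  \<comment> \<open>Mertens' theorem for nonnegative, hence absolutely convergent, series; the power
    \<open>\<rho> ^ d\<close> is split along the cut into \<open>\<rho> ^ k\<close> and
    \<open>\<rho> ^ (d - k)\<close>.\<close>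
  have "summable (\<lambda>d. \<Sum>k\<le>d. ?a k * ?b (d - k))"
    using assms \<rho> by (intro summable_Cauchy_product) (simp_all add: free_ball_algebra_iff)
  then show "summable (\<lambda>d. coeff_norm n (series_mult f g) d * \<rho> ^ d)"
  proof (rule summable_coeff_norm_le [rotated])
    fix d
    have "coeff_norm n (series_mult f g) d * \<rho> ^ d
      \<le> (\<Sum>k\<le>d. coeff_norm n f k * coeff_norm n g (d - k)) * \<rho> ^ d"
      using \<rho> by (intro mult_right_mono coeff_norm_mult) simp
    also have "\<dots> = (\<Sum>k\<le>d. ?a k * ?b (d - k))"
      unfolding sum_distrib_right
      by (intro sum.cong refl) (simp add: mult_ac flip: power_add)
    finally show "coeff_norm n (series_mult f g) d * \<rho> ^ d \<le> (\<Sum>k\<le>d. ?a k * ?b (d - k))" .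
  qed (use \<rho> in simp)
qed

lemma free_ball_algebra_one: "series_one \<in> free_ball_algebra n r"
proof -
  have "coeff_norm n series_one d = 0" if "0 < d" for d
    using that by (auto simp: coeff_norm_def L2_set_def series_one_def words_def intro!: sum.neutral)
  then have "summable (\<lambda>d. coeff_norm n series_one d * \<rho> ^ d)" for \<rho>
    by (intro summable_finite [of "{0}"]) auto
  then show ?thesis
    by (auto simp: free_ball_algebra_iff formal_series_iff series_one_def)
qed

lemma subalgebra_free_ball_algebra: "subalgebra_of_series n (free_ball_algebra n r)"
  unfolding subalgebra_of_series_def
  using free_ball_algebra_one free_ball_algebra_add free_ball_algebra_scale free_ball_algebra_mult
  by (auto simp: free_ball_algebra_iff)

section \<open>Comparison of the topologies\<close>

lemma series_diff_triangle: "series_add (series_diff f g) (series_diff g h) = series_diff f h"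
  by (simp add: fun_eq_iff series_add_def series_diff_def)

text \<open>Domination of each \<open>p\<close>-seminorm by a multiple of some
  \<open>q\<close>-seminorm makes every \<open>p\<close>-ball open for \<open>q\<close>. The set
  \<open>D\<close> holds the differences, on which subadditivity and domination are available; the
  roles of \<open>p\<close> and \<open>q\<close> are kept abstract so that both comparisons
  follow.\<close>

lemma seminorm_topology_finer:
  assumes tri: "\<And>\<rho> f g. \<lbrakk>0 < \<rho>; ereal \<rho> < r; f \<in> D; g \<in> D\<rbrakk> \<Longrightarrow> p \<rho> (series_add f g) \<le> p \<rho> f + p \<rho> g"
    and diff: "\<And>f g. \<lbrakk>f \<in> X; g \<in> X\<rbrakk> \<Longrightarrow> series_diff f g \<in> D"
    and zero: "\<And>\<rho> f. f \<in> X \<Longrightarrow> q \<rho> (series_diff f f) = 0"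
    and dom: "\<And>\<rho>. \<lbrakk>0 < \<rho>; ereal \<rho> < r\<rbrakk> \<Longrightarrow>
      \<exists>\<rho>' C. 0 < \<rho>' \<and> ereal \<rho>' < r \<and> 0 < C \<and> (\<forall>f\<in>D. p \<rho> f \<le> ennreal C * q \<rho>' f)"
    and U: "openin (seminorm_topology r p X) U"
  shows "openin (seminorm_topology r q X) U"
proof -
  let ?q = "seminorm_topology r q X"
  let ?B = "{{g \<in> X. p \<rho> (series_diff g f) < ennreal \<epsilon>} | f \<rho> \<epsilon>. f \<in> X \<and> 0 < \<rho> \<and> ereal \<rho> < r \<and> 0 < \<epsilon>}"
  have "openin ?q S" if "S \<in> ?B" for S
  proof -
    from that obtain f \<rho> \<epsilon> where S: "S = {g \<in> X. p \<rho> (series_diff g f) < ennreal \<epsilon>}"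
      and f: "f \<in> X" and \<rho>: "0 < \<rho>" "ereal \<rho> < r" and "0 < \<epsilon>" by auto
    obtain \<rho>' C where \<rho>': "0 < \<rho>'" "ereal \<rho>' < r" and "0 < C"
      and C: "\<And>f. f \<in> D \<Longrightarrow> p \<rho> f \<le> ennreal C * q \<rho>' f" using dom [OF \<rho>] by blast
    have "\<exists>V. openin ?q V \<and> h \<in> V \<and> V \<subseteq> S" if "h \<in> S" for h
    proof -
      have h: "h \<in> X" and ph: "p \<rho> (series_diff h f) < ennreal \<epsilon>" using that by (auto simp: S)
      obtain a where a: "p \<rho> (series_diff h f) = ennreal a" "0 \<le> a"
        using ph by (cases "p \<rho> (series_diff h f)") auto
      then have "a < \<epsilon>" using ph by (simp add: ennreal_less_iff)
      \<comment> \<open>\<open>\<epsilon> - a\<close> is the room left between \<open>h\<close> and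
        the boundary of the ball; division by \<open>C\<close> compensates for the domination
        constant.\<close>
      define \<delta> where "\<delta> = (\<epsilon> - a) / C"
      have "0 < \<delta>" using \<open>a < \<epsilon>\<close> \<open>0 < C\<close> by (simp add: \<delta>_def)
      define V where "V = {g \<in> X. q \<rho>' (series_diff g h) < ennreal \<delta>}"
      have "openin ?q V"
        unfolding seminorm_topology_def V_def
        by (rule topology_generated_by_Basis) (use h \<rho>' \<open>0 < \<delta>\<close> in auto)
      moreover have "h \<in> V" using h zero \<open>0 < \<delta>\<close> by (simp add: V_def)
      moreover have "g \<in> S" if "g \<in> V" for g
      proof -
        have g: "g \<in> X" and qg: "q \<rho>' (series_diff g h) < ennreal \<delta>" using that by (auto simp: V_def)
        have "p \<rho> (series_diff g f) \<le> p \<rho> (series_diff g h) + p \<rho> (series_diff h f)"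
          using tri [OF \<rho> diff [OF g h] diff [OF h f]] by (simp add: series_diff_triangle)
        also have "p \<rho> (series_diff g h) \<le> ennreal C * q \<rho>' (series_diff g h)"
          by (rule C [OF diff [OF g h]])
        also have "ennreal C * q \<rho>' (series_diff g h) + p \<rho> (series_diff h f) < ennreal (C * \<delta>) + ennreal a"
        proof -
          obtain b where b: "q \<rho>' (series_diff g h) = ennreal b" "0 \<le> b"
            using qg by (cases "q \<rho>' (series_diff g h)") auto
          then have "b < \<delta>" using qg by (simp add: ennreal_less_iff)
          then have "C * b + a < C * \<delta> + a" using \<open>0 < C\<close> by simp
          then show ?thesis
            using b a \<open>0 < C\<close> \<open>0 < \<delta>\<close> by (simp add: ennreal_less_iff flip: ennreal_mult ennreal_plus)
        qed
        also have "ennreal (C * \<delta>) + ennreal a = ennreal \<epsilon>"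
        proof -
          have "C * \<delta> + a = \<epsilon>" "0 \<le> C * \<delta>" using \<open>0 < C\<close> \<open>a < \<epsilon>\<close> by (simp_all add: \<delta>_def)
          then show ?thesis using a(2) by (metis ennreal_plus)
        qed
        finally show ?thesis by (simp add: S g)
      qed
      ultimately show ?thesis by blast
    qed
    then show ?thesis using openin_subopen by blast
  qed
  moreover have "generate_topology_on ?B U"
    using U unfolding seminorm_topology_def by (rule openin_topology_generated_by)
  ultimately show ?thesis
    \<comment> \<open>The generated topology is the coarsest containing its generators, so the balls
      were the only sets to check.\<close>
    using generate_topology_on_coarsest [OF istopology_openin] by blast
qed

section \<open>Subadditivity and mutual domination of the seminorms\<close>

lemma summable_free_ball:
  assumes "f \<in> free_ball_algebra n r" and "0 < \<rho>" and "ereal \<rho> < r"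
  shows "summable (\<lambda>d. coeff_norm n f d * \<rho> ^ d)"
  using assms by (simp add: free_ball_algebra_iff)

lemma free_ball_norm_add:
  assumes "0 \<le> \<rho>"
  shows "free_ball_norm n \<rho> (series_add f g) \<le> free_ball_norm n \<rho> f + free_ball_norm n \<rho> g"
proof -
  have "ennreal (coeff_norm n (series_add f g) d * \<rho> ^ d)
    \<le> ennreal (coeff_norm n f d * \<rho> ^ d) + ennreal (coeff_norm n g d * \<rho> ^ d)" for d
    using \<open>0 \<le> \<rho>\<close> mult_right_mono [OF coeff_norm_add, of "\<rho> ^ d" n f g d]
    by (simp add: distrib_right flip: ennreal_plus)
  then show ?thesis
    unfolding free_ball_norm_def L2_set_def [symmetric] coeff_norm_def [symmetric]
    by (subst suminf_add) (auto intro!: suminf_le)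
qed

lemma popescu_seminorm_le_free_ball_norm:
  assumes "0 \<le> \<rho>" and "summable (\<lambda>d. coeff_norm n f d * \<rho> ^ d)"
  shows "popescu_seminorm TYPE('h::complex_hilbert_space) n \<rho> f \<le> free_ball_norm n \<rho> f"
  unfolding popescu_seminorm_def free_ball_norm_eq [OF assms]
  using summable_series_eval(2) assms(2) by (intro SUP_least ennreal_leI) auto

text \<open>Additivity of \<open>suminf\<close> rests on convergence of both evaluations, which the
  two summability hypotheses supply.\<close>

lemma series_eval_add:
  fixes T :: "nat \<Rightarrow> ('h::complex_hilbert_space \<Rightarrow>\<^sub>L 'h)"
  assumes "\<forall>i\<in>{1..n}. T i \<in> bounded_ops" and "tuple_norm n T \<le> \<rho>"
    and "summable (\<lambda>d. coeff_norm n f d * \<rho> ^ d)" and "summable (\<lambda>d. coeff_norm n g d * \<rho> ^ d)"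
  shows "series_eval n (series_add f g) T = series_eval n f T + series_eval n g T"
proof -
  have "scale_op (b + c) S = scale_op b S + scale_op c S" for b c and S :: "'h \<Rightarrow>\<^sub>L 'h"
    by (rule blinfun_eqI) (simp add: scale_op.rep_eq blinfun.add_left scaleC_add_left)
  then show ?thesis
    unfolding series_eval_def
    using suminf_add [OF summable_series_eval(1) [OF assms(1-3)] summable_series_eval(1) [OF assms(1,2,4)]]
    by (simp add: series_add_def sum.distrib)
qed

lemma popescu_seminorm_add:
  assumes "summable (\<lambda>d. coeff_norm n f d * \<rho> ^ d)" and "summable (\<lambda>d. coeff_norm n g d * \<rho> ^ d)"
  shows "popescu_seminorm TYPE('h::complex_hilbert_space) n \<rho> (series_add f g)
    \<le> popescu_seminorm TYPE('h) n \<rho> f + popescu_seminorm TYPE('h) n \<rho> g"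
  unfolding popescu_seminorm_def [of _ n \<rho> "series_add f g"]
proof (rule SUP_least)
  fix T :: "nat \<Rightarrow> ('h \<Rightarrow>\<^sub>L 'h)"
  assume T: "T \<in> {T. (\<forall>i\<in>{1..n}. T i \<in> bounded_ops) \<and> tuple_norm n T \<le> \<rho>}"
  then have "series_eval n (series_add f g) T = series_eval n f T + series_eval n g T"
    using series_eval_add assms by blast
  then have "ennreal (norm (series_eval n (series_add f g) T))
    \<le> ennreal (norm (series_eval n f T)) + ennreal (norm (series_eval n g T))"
    by (simp add: norm_triangle_ineq flip: ennreal_plus)
  also have "\<dots> \<le> popescu_seminorm TYPE('h) n \<rho> f + popescu_seminorm TYPE('h) n \<rho> g"
    unfolding popescu_seminorm_def by (intro add_mono SUP_upper T)
  finally show "ennreal (norm (series_eval n (series_add f g) T))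
    \<le> popescu_seminorm TYPE('h) n \<rho> f + popescu_seminorm TYPE('h) n \<rho> g" .
qed

text \<open>Each single degree is controlled at radius \<open>\<rho>'\<close>. Shrinking the radius
  to \<open>\<rho>\<close> gains a factor \<open>(\<rho> / \<rho>') ^ d\<close>, which makes the sum
  over all degrees converge; the constant is the sum of that geometric series.\<close>

lemma free_ball_norm_le_popescu_seminorm:
  assumes "infinite_dimensional TYPE('h::complex_hilbert_space)" and "0 < \<rho>" and "\<rho> < \<rho>'"
    and "summable (\<lambda>d. coeff_norm n f d * \<rho>' ^ d)"
  shows "free_ball_norm n \<rho> f \<le> ennreal (1 / (1 - \<rho> / \<rho>')) * popescu_seminorm TYPE('h) n \<rho>' f"
proof -
  let ?t = "\<rho> / \<rho>'" and ?P = "popescu_seminorm TYPE('h) n \<rho>' f"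
  have t: "0 \<le> ?t" "?t < 1" using assms(2,3) by simp_all
  have "ennreal (coeff_norm n f d * \<rho> ^ d) \<le> ennreal (?t ^ d) * ?P" for d
  proof -
    have "coeff_norm n f d * \<rho> ^ d = ?t ^ d * (coeff_norm n f d * \<rho>' ^ d)"
      using assms(2,3) by (simp add: power_divide)
    then have "ennreal (coeff_norm n f d * \<rho> ^ d) = ennreal (?t ^ d) * ennreal (coeff_norm n f d * \<rho>' ^ d)"
      using t(1) assms(2,3) by (metis ennreal_mult' zero_le_power)
    also have "\<dots> \<le> ennreal (?t ^ d) * ?P"
      using assms by (intro mult_left_mono coeff_norm_le_popescu_seminorm) simp_all
    finally show ?thesis .
  qed
  then have "free_ball_norm n \<rho> f \<le> (\<Sum>d. ennreal (?t ^ d) * ?P)"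
    unfolding free_ball_norm_def L2_set_def [symmetric] coeff_norm_def [symmetric]
    by (intro suminf_le) auto
  also have "\<dots> = (\<Sum>d. ennreal (?t ^ d)) * ?P" by simp
  also have "(\<Sum>d. ennreal (?t ^ d)) = ennreal (1 / (1 - ?t))"
    using t suminf_geometric [of ?t] by (subst suminf_ennreal2) (simp_all add: summable_geometric)
  finally show ?thesis .
qed

lemma seminorm_zero:
  shows "free_ball_norm n \<rho> (series_diff f f) = 0"
    and "popescu_seminorm TYPE('h::complex_hilbert_space) n \<rho> (series_diff f f) = 0"
proof -
  have "scale_op 0 S = 0" for S :: "'h \<Rightarrow>\<^sub>L 'h"
    by (rule blinfun_eqI) (simp add: scale_op.rep_eq)
  then show "popescu_seminorm TYPE('h::complex_hilbert_space) n \<rho> (series_diff f f) = 0"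
    \<comment> \<open>For negative \<open>\<rho>\<close> no tuple qualifies, and the empty supremum
      is \<open>bot\<close>, which is 0 in \<open>ennreal\<close>.\<close>
    by (simp add: popescu_seminorm_def series_eval_def series_diff_def image_constant_conv bot_ennreal)
qed (simp add: free_ball_norm_def series_diff_def)

theorem proposition4p3:
  fixes n :: nat and r :: ereal
  assumes "infinite_dimensional TYPE('h::complex_hilbert_space)"
    and "0 < r"
  shows "subalgebra_of_series n (popescu_algebra n r) \<and>
    popescu_algebra n r = free_ball_algebra n r \<and>
    popescu_topology TYPE('h) n r = free_ball_topology n r"
proof (intro conjI)
  show "subalgebra_of_series n (popescu_algebra n r)"
    by (simp add: popescu_algebra_eq subalgebra_free_ball_algebra)
  show "popescu_algebra n r = free_ball_algebra n r" by (rule popescu_algebra_eq)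
  let ?A = "free_ball_algebra n r"
  have "openin (seminorm_topology r (free_ball_norm n) ?A) U"
    if "openin (seminorm_topology r (popescu_seminorm TYPE('h) n) ?A) U" for U
  proof (rule seminorm_topology_finer [OF _ _ _ _ that, where D = ?A])
    fix \<rho> :: real assume \<rho>: "0 < \<rho>" "ereal \<rho> < r"
    \<comment> \<open>In this direction the radius is kept and the constant is 1.\<close>
    have "popescu_seminorm TYPE('h) n \<rho> f \<le> ennreal 1 * free_ball_norm n \<rho> f" if "f \<in> ?A" for f
      using popescu_seminorm_le_free_ball_norm [where 'h = 'h] summable_free_ball [OF that \<rho>] \<rho> by simp
    then show "\<exists>\<rho>' C. 0 < \<rho>' \<and> ereal \<rho>' < r \<and> 0 < C \<and>
        (\<forall>f\<in>?A. popescu_seminorm TYPE('h) n \<rho> f \<le> ennreal C * free_ball_norm n \<rho>' f)"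
      using \<rho> zero_less_one by blast
  qed (simp_all add: free_ball_algebra_diff seminorm_zero popescu_seminorm_add summable_free_ball)
  moreover have "openin (seminorm_topology r (popescu_seminorm TYPE('h) n) ?A) U"
    if "openin (seminorm_topology r (free_ball_norm n) ?A) U" for U
  proof (rule seminorm_topology_finer [OF _ _ _ _ that, where D = ?A])
    fix \<rho> :: real assume \<rho>: "0 < \<rho>" "ereal \<rho> < r"
    \<comment> \<open>This direction costs a larger radius; the strict inequality between
      \<open>\<rho>\<close> and \<open>r\<close> leaves room for a real one, also when
      \<open>r\<close> is infinite.\<close>
    then obtain \<rho>' where \<rho>': "\<rho> < \<rho>'" "ereal \<rho>' < r"
      using ereal_dense2 [of "ereal \<rho>" r] by auto
    have "free_ball_norm n \<rho> f \<le> ennreal (1 / (1 - \<rho> / \<rho>')) * popescu_seminorm TYPE('h) n \<rho>' f"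
      if "f \<in> ?A" for f
      using assms(1) \<rho>(1) \<rho>'(1)
      by (rule free_ball_norm_le_popescu_seminorm) (use summable_free_ball [OF that] \<rho> \<rho>' in simp)
    moreover have "0 < 1 / (1 - \<rho> / \<rho>')" using \<rho> \<rho>' by simp
    ultimately show "\<exists>\<rho>' C. 0 < \<rho>' \<and> ereal \<rho>' < r \<and> 0 < C \<and>
        (\<forall>f\<in>?A. free_ball_norm n \<rho> f \<le> ennreal C * popescu_seminorm TYPE('h) n \<rho>' f)"
      using \<rho> \<rho>' by (meson less_trans)
  qed (simp_all add: free_ball_algebra_diff seminorm_zero free_ball_norm_add)
  ultimately show "popescu_topology TYPE('h) n r = free_ball_topology n r"
    unfolding popescu_topology_def free_ball_topology_def popescu_algebra_eq topology_eq by blast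
qed

end
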